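(* Let $n\ge1$ and let $T^n$ be the $l^1$-torus with uniform probability measure $m_{T^n}$. For any closed subset $\Omega\subset T^n$ with $m_{T^n}(\Omega)>0$, let $B_\Omega$ be a metric ball of $T^n$ with $m_{T^n}(B_\Omega)=m_{T^n}(\Omega)$. Then \[ m_{T^n}(U_r(\Omega))\ge m_{T^n}(U_r(B_\Omega)) \] for any $r>0$.
   Context: The $l^1$-torus $T^n$ is the $n$-fold $l^1$-product of the circle $S^1$ (the unit circle with geodesic distance $d_{S^1}$): its distance is $d((x_i),(y_i))=\sum_{i=1}^n d_{S^1}(x_i,y_i)$, and $m_{T^n}$ is the $n$-fold product of the normalized arc-length measure on $S^1$. Metric balls are taken with respect to this $l^1$-distance. For $A\subset T^n$, $U_r(A):=\{x\in T^n\mid \inf_{y\in A}d(x,y)<r\}$ is the open $r$-neighborhood with respect to the $l^1$-distance. *)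

theory Defs
  imports "HOL-Probability.Probability"
begin

text \<open>The circle is the unit circle in the complex plane. The geodesic distance of two of its
  points is the length of the shorter arc between them, i.e. the modulus of the principal argument
  (which lies in \<open>(-\<pi>, \<pi>]\<close>) of their quotient.\<close>

definition circle :: "complex set" where
  "circle = sphere 0 1"

definition circle_dist :: "complex \<Rightarrow> complex \<Rightarrow> real" where
  "circle_dist x y = \<bar>Arg (x / y)\<bar>"

text \<open>Arc length, normalized to total mass 1, is the image of the uniform distribution on an
  interval of length \<open>2\<pi>\<close> under the arc-length parametrization.\<close>

definition circle_measure :: "complex measure" where
  "circle_measure =
     distr (uniform_measure lborel {0..<2 * pi}) (restrict_space borel circle) cis"

definition torus :: "nat \<Rightarrow> (nat \<Rightarrow> complex) set" where
  "torus n = {..<n} \<rightarrow>\<^sub>E circle"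

definition torus_dist :: "nat \<Rightarrow> (nat \<Rightarrow> complex) \<Rightarrow> (nat \<Rightarrow> complex) \<Rightarrow> real" where
  "torus_dist n x y = (\<Sum>i<n. circle_dist (x i) (y i))"

definition torus_measure :: "nat \<Rightarrow> (nat \<Rightarrow> complex) measure" where
  "torus_measure n = PiM {..<n} (\<lambda>_. circle_measure)"

abbreviation torus_topology :: "nat \<Rightarrow> (nat \<Rightarrow> complex) topology" where
  "torus_topology n \<equiv> Metric_space.mtopology (torus n) (torus_dist n)"

text \<open>Both open and closed balls count as metric balls.\<close>

definition torus_ball :: "nat \<Rightarrow> (nat \<Rightarrow> complex) set \<Rightarrow> bool" where
  "torus_ball n B \<longleftrightarrow> (\<exists>c\<in>torus n. \<exists>R>0.
     B = Metric_space.mball (torus n) (torus_dist n) c R \<or>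
     B = Metric_space.mcball (torus n) (torus_dist n) c R)"

text \<open>The infimum is taken in the reals, so this is meant for nonempty \<open>A\<close> only.\<close>

definition torus_nbhd :: "nat \<Rightarrow> real \<Rightarrow> (nat \<Rightarrow> complex) set \<Rightarrow> (nat \<Rightarrow> complex) set" where
  "torus_nbhd n r A = {x \<in> torus n. (INF y\<in>A. torus_dist n x y) < r}"


lemma abs_Arg_cis_le: "\<bar>Arg (cis t)\<bar> \<le> \<bar>t\<bar>"
proof (cases "-pi < t \<and> t \<le> pi")
  case True
  then have "Arg (cis t) = t"
    by (intro cis_Arg_unique) (auto simp: sgn_eq)
  then show ?thesis by simp
next
  case False
  then have "pi \<le> \<bar>t\<bar>" by auto
  then show ?thesis using Arg_bounded[of "cis t"] by linarith
qed

lemma abs_Arg_mult_le: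
  assumes "cmod w = 1" "cmod z = 1"
  shows "\<bar>Arg (w * z)\<bar> \<le> \<bar>Arg w\<bar> + \<bar>Arg z\<bar>"
proof -
  have "w = cis (Arg w)" "z = cis (Arg z)"
    using assms by (metis mult_1 of_real_1 rcis_cmod_Arg rcis_def)+
  then have "w * z = cis (Arg w + Arg z)"
    by (metis cis_mult)
  then show ?thesis
    using abs_Arg_cis_le[of "Arg w + Arg z"] by simp
qed

lemma circle_dist_commute: "circle_dist x y = circle_dist y x"
proof (cases "x = 0 \<or> y = 0")
  case True
  then show ?thesis by (auto simp: circle_dist_def)
next
  case False
  have le: "\<bar>Arg (inverse z)\<bar> \<le> \<bar>Arg z\<bar>" if "z \<noteq> 0" for z
  proof -
    have "Arg (inverse z) = Arg (cis (- Arg z))"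
    proof (rule cis_Arg_unique)
      have "cis (Arg (cis (- Arg z))) = cis (- Arg z)"
        by (simp add: cis_Arg sgn_eq)
      also have "\<dots> = inverse (sgn z)"
        using that by (simp add: cis_Arg flip: cis_inverse)
      also have "\<dots> = sgn (inverse z)"
        using that by (simp add: sgn_eq norm_inverse norm_divide field_simps)
      finally show "sgn (inverse z) = cis (Arg (cis (- Arg z)))" by simp
    qed (use Arg_bounded in auto)
    then show ?thesis using abs_Arg_cis_le[of "- Arg z"] by simp
  qed
  have "\<bar>Arg (x / y)\<bar> \<le> \<bar>Arg (y / x)\<bar>" "\<bar>Arg (y / x)\<bar> \<le> \<bar>Arg (x / y)\<bar>"
    using le[of "y / x"] le[of "x / y"] False by auto
  then show ?thesis by (simp add: circle_dist_def)
qed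

lemma circle_dist_triangle:
  assumes "x \<in> circle" "y \<in> circle" "z \<in> circle"
  shows "circle_dist x z \<le> circle_dist x y + circle_dist y z"
proof -
  have "y \<noteq> 0" using assms by (auto simp: circle_def)
  then have "x / z = (x / y) * (y / z)" by simp
  moreover have "cmod (x / y) = 1" "cmod (y / z) = 1"
    using assms by (simp_all add: circle_def norm_divide)
  ultimately show ?thesis
    unfolding circle_dist_def by (metis abs_Arg_mult_le)
qed

lemma circle_dist_eq_0:
  assumes "x \<in> circle" "y \<in> circle"
  shows "circle_dist x y = 0 \<longleftrightarrow> x = y"
proof -
  have "x = y" if "Arg (x / y) = 0"
  proof -
    have "cmod (x / y) = 1" "y \<noteq> 0"
      using assms by (auto simp: circle_def norm_divide)
    moreover have "x / y = rcis (cmod (x / y)) 0"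
      using rcis_cmod_Arg[of "x / y"] that by simp
    ultimately have "x / y = 1" by (simp add: rcis_def)
    then show ?thesis using \<open>y \<noteq> 0\<close> by simp
  qed
  then show ?thesis using assms by (auto simp: circle_dist_def circle_def)
qed

lemma Metric_space_torus: "Metric_space (torus n) (torus_dist n)"
proof
  have nn: "0 \<le> circle_dist a b" for a b by (simp add: circle_dist_def)
  show "0 \<le> torus_dist n x y" for x y
    by (simp add: torus_dist_def nn sum_nonneg)
  show "torus_dist n x y = torus_dist n y x" for x y
    by (simp add: torus_dist_def circle_dist_commute)
  show "torus_dist n x y = 0 \<longleftrightarrow> x = y" if "x \<in> torus n" "y \<in> torus n" for x y
  proof -
    have "torus_dist n x y = 0 \<longleftrightarrow> (\<forall>i<n. circle_dist (x i) (y i) = 0)"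
      unfolding torus_dist_def by (subst sum_nonneg_eq_0_iff) (auto simp: nn)
    also have "\<dots> \<longleftrightarrow> (\<forall>i<n. x i = y i)"
      using that by (auto simp: torus_def PiE_iff circle_dist_eq_0)
    also have "\<dots> \<longleftrightarrow> x = y"
      using that unfolding torus_def by (metis PiE_ext lessThan_iff)
    finally show ?thesis .
  qed
  show "torus_dist n x z \<le> torus_dist n x y + torus_dist n y z"
    if "x \<in> torus n" "y \<in> torus n" "z \<in> torus n" for x y z
    using that unfolding torus_dist_def sum.distrib[symmetric]
    by (intro sum_mono circle_dist_triangle) (auto simp: torus_def PiE_iff)
qed

lemma prob_space_circle_measure: "prob_space circle_measure"
proof -
  interpret prob_space "uniform_measure lborel {0..<2 * pi}"
    by (rule prob_space_uniform_measure) auto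
  have "cis \<in> borel_measurable borel"
    by (intro borel_measurable_continuous_onI continuous_intros)
  then have "cis \<in> measurable (uniform_measure lborel {0..<2 * pi}) (restrict_space borel circle)"
    by (intro measurable_restrict_space2) (auto simp: circle_def)
  then show ?thesis
    unfolding circle_measure_def by (rule prob_space_distr)
qed

lemma prob_space_torus_measure: "prob_space (torus_measure n)"
  unfolding torus_measure_def by (intro prob_space_PiM prob_space_circle_measure)

lemma space_torus_measure: "space (torus_measure n) = torus n"
  by (simp add: torus_measure_def torus_def space_PiM circle_measure_def space_restrict_space)

end

theory Submission
  imports Defs
begin

text \<open>The theorem is the limit of an isoperimetric inequality on the discrete torus, the \<open>n\<close>-th power of a
  cycle of length \<open>K\<close>, as \<open>K\<close> tends to infinity. The discrete inequality is proved in two steps.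

  First, compression: in each coordinate direction in turn, the fibres of a set are replaced by
  initial segments of \<open>{..<K}\<close> of the same size (\<open>compress\<close>). Neighbourhoods do not grow, because a
  nonempty set in a cycle gains at least two points per step until it fills the cycle, as an
  arc does (\<open>card_circ_nbhd\<close>). In this way the torus is folded to a cube, the set
  becomes one that is closed under decreasing coordinates, and balls become simplices
  \<open>{x. x\<^sub>1 + \<dots> + x\<^sub>n \<le> t}\<close> at a corner of the cube.

  Second, simplices are optimal among such sets (\<open>grid_isoperimetry\<close>), by induction on the dimension.
  Slices are replaced by simplices, fractional ones since volumes must match exactly.
  This leaves the problem of comparing a stack of simplices of sizes \<open>\<psi> j - j\<close> at the heights \<open>j\<close> with
  the simplex, where \<open>\<psi>\<close> is constant (\<open>profile_step\<close>). Where \<open>\<psi>\<close> decreases, the stack is steep and its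
  vertical growth alone shows that averaging \<open>\<psi>\<close> is an improvement (\<open>isotonic_regression\<close>). Where
  \<open>\<psi>\<close> increases, the stack is flat and grows slice by slice, and the comparison follows from
  concavity of the isoperimetric profile of the slices, which is the log-concavity of the
  volumes (\<open>simplex_vol_shift_inequality\<close>).

  For the passage to the torus, the set \<open>\<Omega>\<close> is covered by products of short arcs, and the ball is
  compared with simplices by cutting each circle into shells of equal measure around the
  coordinates of its centre. The error is a number of mesh lengths that depends on \<open>n\<close> only, and
  disappears in the limit because the measure of an open ball is continuous from the left in the radius.\<close>

section \<open>Volumes of simplices in a grid\<close>

text \<open>\<open>simplex_vol K n t\<close> is the volume of the simplex of size \<open>t\<close> at a corner of the cube \<open>{0..<K}\<^sup>n\<close>,
  interpolated so that every real size makes sense: the grid point \<open>x\<close> is filled to the degree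
  \<open>t - (x\<^sub>1 + \<dots> + x\<^sub>n)\<close>, clipped to the unit interval. Partially filled points are
  what makes an induction on the dimension possible, because the slices of a set rarely have
  exactly the size of a simplex with integer parameter. The recursion on \<open>n\<close> slices the cube
  along one coordinate.\<close>

primrec simplex_vol :: "nat \<Rightarrow> nat \<Rightarrow> real \<Rightarrow> real" where
  "simplex_vol K 0 t = max 0 (min 1 t)"
| "simplex_vol K (Suc n) t = (\<Sum>j<K. simplex_vol K n (t - real j))"

lemma simplex_vol_nonneg: "0 \<le> simplex_vol K n t"
  by (induction n arbitrary: t) (auto intro: sum_nonneg)

lemma simplex_vol_nonpos: "t \<le> 0 \<Longrightarrow> simplex_vol K n t = 0"
  by (induction n arbitrary: t) auto

lemma simplex_vol_mono: "x \<le> y \<Longrightarrow> simplex_vol K n x \<le> simplex_vol K n y"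
  by (induction n arbitrary: x y) (auto intro!: sum_mono)

lemma continuous_simplex_vol: "continuous_on UNIV (simplex_vol K n)"
proof (induction n)
  case 0
  show ?case by (simp, intro continuous_intros)
next
  case (Suc n)
  have "continuous_on UNIV (\<lambda>t. simplex_vol K n (t - real j))" for j
    by (rule continuous_on_compose2[OF Suc]) (auto intro!: continuous_intros)
  then show ?case by (simp, intro continuous_intros)
qed

lemma simplex_vol_full:
  assumes "real (n * (K - 1)) + 1 \<le> t"
  shows "simplex_vol K n t = real K ^ n"
  using assms
proof (induction n arbitrary: t)
  case (Suc n)
  have "simplex_vol K n (t - real j) = real K ^ n" if "j < K" for j
  proof (rule Suc.IH)
    have "real j \<le> real (K - 1)" using that by simp
    moreover have "real (Suc n * (K - 1)) = real (K - 1) + real (n * (K - 1))"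
      by (metis mult_Suc of_nat_add)
    ultimately show "real (n * (K - 1)) + 1 \<le> t - real j"
      using Suc.prems by linarith
  qed
  then show ?case by simp
qed auto

lemma simplex_vol_strict_mono:
  assumes "K \<ge> 1" "x < y" "0 < y" "x < real (n * (K - 1)) + 1"
  shows "simplex_vol K n x < simplex_vol K n y"
  using assms(2-)
proof (induction n arbitrary: x y)
  case (Suc n)
  have top: "real (Suc n * (K - 1)) = real (K - 1) + real (n * (K - 1))"
    by (metis mult_Suc of_nat_add)
  have "\<exists>j<K. 0 < y - real j \<and> x - real j < real (n * (K - 1)) + 1"
  proof (cases "y > real (K - 1)")
    case True
    moreover have "x - real (K - 1) < real (n * (K - 1)) + 1"
      using Suc.prems(3) top by linarith
    ultimately show ?thesis using assms(1)
      by (intro exI[of _ "K - 1"]) simp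
  next
    case False
    define j where "j = nat (\<lceil>y\<rceil> - 1)"
    have *: "real j < y" "y \<le> real j + 1"
      using Suc.prems(2) unfolding j_def by linarith+
    moreover have "j < K"
    proof -
      have "real j < real (K - 1)" using * False by linarith
      then show ?thesis by simp
    qed
    moreover have "0 \<le> real (n * (K - 1))" by simp
    ultimately show ?thesis using Suc.prems(1)
      by (intro exI[of _ j] conjI) linarith+
  qed
  then obtain j where j: "j < K" "0 < y - real j" "x - real j < real (n * (K - 1)) + 1"
    by blast
  show ?case unfolding simplex_vol.simps
    by (rule sum_strict_mono_ex1) (use j Suc.prems Suc.IH[of "x - real j" "y - real j"] in
      \<open>auto intro!: simplex_vol_mono\<close>)
qed auto

text \<open>Growing a simplex by one unit turns the volume \<open>b t\<close> into \<open>b (t + 1)\<close>. For \<open>e = 1\<close> the inequality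
  says that \<open>b (t + 1)\<close> is a concave function of \<open>b t\<close>: the chord slopes over \<open>[r, s]\<close> are at most
  those over \<open>[p, q]\<close> further left. It is a form of log-concavity, and like log-concavity it is
  inherited by convolution with \<open>{0..<K}\<close>, which is the step from \<open>n\<close> to \<open>Suc n\<close>. For this
  inheritance the shifts \<open>e > 1\<close> are needed as well; they follow by iterating the case
  \<open>e = 1\<close>, as the volume is strictly increasing until the whole cube is filled, so that the
  factors to be cancelled do not vanish.\<close>

lemma simplex_vol_shift_inequality:
  assumes "K \<ge> 1" "p \<le> q" "q \<le> r" "r \<le> s"
  shows "(simplex_vol K n q - simplex_vol K n p) *
           (simplex_vol K n (s + real e) - simplex_vol K n (r + real e))
       \<le> (simplex_vol K n (q + real e) - simplex_vol K n (p + real e)) *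
           (simplex_vol K n s - simplex_vol K n r)"
  using assms(2-)
proof (induction n arbitrary: p q r s e)
  case 0
  show ?case
  proof (cases "e = 0 \<or> q \<le> 0")
    case True
    then show ?thesis using 0 by (auto simp: mult_nonneg_nonneg)
  next
    case False
    then have "1 \<le> r + real e" "1 \<le> s + real e"
      using 0 by (auto simp: not_le Suc_le_eq[symmetric] intro: add_increasing)
    then show ?thesis using 0 by (simp add: mult_nonneg_nonneg)
  qed
next
  case (Suc n)
  note prems = Suc.prems
  define b where "b = simplex_vol K n"
  define b' where "b' = simplex_vol K (Suc n)"
  have b': "b' t = (\<Sum>j<K. b (t - real j))" for t by (simp add: b_def b'_def)
  have mono': "x \<le> y \<Longrightarrow> b' x \<le> b' y" for x y
    unfolding b'_def by (rule simplex_vol_mono)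
  have one: "(b' q - b' p) * (b' (s + 1) - b' (r + 1)) \<le> (b' (q + 1) - b' (p + 1)) * (b' s - b' r)"
    if "p \<le> q" "q \<le> r" "r \<le> s" for p q r s
  proof -
    define \<alpha> where "\<alpha> i = b (q + i) - b (p + i)" for i
    define \<gamma> where "\<gamma> i = b (s + i) - b (r + i)" for i
    define \<alpha>0 \<gamma>0 where "\<alpha>0 = (\<Sum>j<K. \<alpha> (- real j))" and "\<gamma>0 = (\<Sum>j<K. \<gamma> (- real j))"
    have shift: "(\<Sum>j<K. g (1 - real j)) = (\<Sum>j<K. g (- real j)) + g 1 - g (1 - real K)" for g :: "real \<Rightarrow> real"
      by (induction K) (auto simp: algebra_simps)
    have q1: "b' q - b' p = \<alpha>0" "b' s - b' r = \<gamma>0"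
      by (simp_all add: b' \<alpha>0_def \<gamma>0_def \<alpha>_def \<gamma>_def sum_subtractf)
    have q2: "b' (q + 1) - b' (p + 1) = \<alpha>0 + \<alpha> 1 - \<alpha> (1 - real K)"
      "b' (s + 1) - b' (r + 1) = \<gamma>0 + \<gamma> 1 - \<gamma> (1 - real K)"
      unfolding \<alpha>0_def \<gamma>0_def shift[symmetric]
      by (simp_all add: b' \<alpha>_def \<gamma>_def sum_subtractf add.commute add_diff_eq)
    have IH: "\<alpha> i * \<gamma> (i + real e) \<le> \<alpha> (i + real e) * \<gamma> i" for i e
      using Suc.IH[of "p + i" "q + i" "r + i" "s + i" e] that
      by (simp add: \<alpha>_def \<gamma>_def b_def algebra_simps)
    have t1: "\<alpha> (- real j) * \<gamma> 1 \<le> \<alpha> 1 * \<gamma> (- real j)" for j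
      using IH[of "- real j" "Suc j"] by simp
    have t2: "\<alpha> (1 - real K) * \<gamma> (- real j) \<le> \<alpha> (- real j) * \<gamma> (1 - real K)" if "j < K" for j
    proof -
      have "1 - real K + real (K - 1 - j) = - real j"
        using that assms(1) by (simp add: of_nat_diff)
      then show ?thesis using IH[of "1 - real K" "K - 1 - j"] by metis
    qed
    \<comment> \<open>A window of length \<open>K\<close> that moves by one changes only at its two ends; the two claims
      compare the entering and the leaving terms separately.\<close>
    have "\<alpha>0 * \<gamma> 1 \<le> \<alpha> 1 * \<gamma>0" unfolding \<alpha>0_def \<gamma>0_def sum_distrib_left sum_distrib_right
      by (intro sum_mono t1)
    moreover have "\<alpha> (1 - real K) * \<gamma>0 \<le> \<alpha>0 * \<gamma> (1 - real K)"
      unfolding \<alpha>0_def \<gamma>0_def sum_distrib_left sum_distrib_right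
      by (intro sum_mono t2) auto
    ultimately show ?thesis unfolding q1 q2 by (simp add: algebra_simps)
  qed
  have "(b' q - b' p) * (b' (s + real e) - b' (r + real e))
      \<le> (b' (q + real e) - b' (p + real e)) * (b' s - b' r)"
  proof (induction e)
    case (Suc e)
    define \<alpha> where "\<alpha> i = b' (q + i) - b' (p + i)" for i
    define \<gamma> where "\<gamma> i = b' (s + i) - b' (r + i)" for i
    have nn: "0 \<le> \<alpha> i" "0 \<le> \<gamma> i" for i
      using \<open>p \<le> q\<close> \<open>r \<le> s\<close> by (auto simp: \<alpha>_def \<gamma>_def intro: mono')
    have i1: "\<alpha> 0 * \<gamma> e \<le> \<alpha> e * \<gamma> 0" using Suc.IH by (simp add: \<alpha>_def \<gamma>_def)
    have i2: "\<alpha> e * \<gamma> (Suc e) \<le> \<alpha> (Suc e) * \<gamma> e"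
      using one[of "p + e" "q + e" "r + e" "s + e"] prems
      by (simp add: \<alpha>_def \<gamma>_def add_ac)
    have "\<alpha> 0 * \<gamma> (Suc e) \<le> \<alpha> (Suc e) * \<gamma> 0"
    proof (cases "\<alpha> 0 = 0 \<or> \<gamma> (Suc e) = 0")
      case True
      then show ?thesis using nn by (auto simp: mult_nonneg_nonneg)
    next
      case False
      have q: "p < q" "0 < q" using False prems simplex_vol_nonpos[of q K "Suc n"]
          simplex_vol_nonpos[of p K "Suc n"] unfolding \<alpha>_def b'_def
        by (force simp del: simplex_vol.simps)+
      have r: "r < s" "r + real (Suc e) < real (Suc n * (K - 1)) + 1"
        using False prems simplex_vol_full[of "Suc n" K "r + real (Suc e)"]
          simplex_vol_full[of "Suc n" K "s + real (Suc e)"] unfolding \<gamma>_def b'_def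
        by (force simp del: simplex_vol.simps of_nat_Suc mult_Suc)+
      have "0 < \<alpha> e" unfolding \<alpha>_def b'_def
        using simplex_vol_strict_mono[of K "p + e" "q + e" "Suc n"] q r assms(1) \<open>q \<le> r\<close>
        by (simp del: simplex_vol.simps mult_Suc)
      moreover have "0 < \<gamma> e" unfolding \<gamma>_def b'_def
        using simplex_vol_strict_mono[of K "r + e" "s + e" "Suc n"] q r assms(1) \<open>q \<le> r\<close>
        by (simp del: simplex_vol.simps mult_Suc)
      ultimately have pos: "0 < \<alpha> e * \<gamma> e" by simp
      have "(\<alpha> 0 * \<gamma> e) * (\<alpha> e * \<gamma> (Suc e)) \<le> (\<alpha> e * \<gamma> 0) * (\<alpha> (Suc e) * \<gamma> e)"
        by (rule mult_mono[OF i1 i2]) (auto intro!: mult_nonneg_nonneg nn)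
      then have "(\<alpha> 0 * \<gamma> (Suc e)) * (\<alpha> e * \<gamma> e) \<le> (\<alpha> (Suc e) * \<gamma> 0) * (\<alpha> e * \<gamma> e)"
        by (simp add: mult_ac)
      then show ?thesis using pos by (simp only: mult_le_cancel_right_pos)
    qed
    then show ?case by (simp add: \<alpha>_def \<gamma>_def)
  qed (use prems in simp)
  then show ?case by (simp only: b'_def)
qed

section \<open>A one-dimensional isoperimetric problem\<close>

text \<open>In a stack of slices, let the slice at height \<open>j\<close> have the volume of a simplex of size
  \<open>\<psi> j - j\<close>; a constant \<open>\<psi>\<close> thus describes a simplex. In the neighbourhood of the stack, the slice
  at height \<open>j\<close> has volume \<open>e j\<close>, and it contains both the neighbourhood of the \<open>j\<close>-th slice
  (\<open>grow\<close>) and the slice below it (\<open>shift\<close>).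

  If \<open>\<psi>\<close> decreases along a block of heights, then bounding \<open>e\<close> by the slices below, except at the
  start of the block, shows that the block does no better than the block of the same volume with
  constant \<open>\<psi>\<close>: the gain is the growth of the first slice minus the last slice, and a
  constant value lowers the former and raises the latter. Replacing \<open>\<psi>\<close> by its isotonic
  regression \<open>c\<close> therefore preserves the volume, does not increase the neighbourhood, and
  leaves only increasing profiles to be considered.

  The regression is built from the bottom: the first value is the largest constant whose
  volume does not exceed that of \<open>\<psi>\<close> on any initial segment, and the first block is the longest
  initial segment on which equality holds. The first two conjuncts are for the induction only: they make it
  possible to join the next block, with a value that is at least as large and with slices that
  are no larger.\<close>

lemma isotonic_regression:
  fixes b :: "real \<Rightarrow> real" and \<psi> e :: "nat \<Rightarrow> real"
  assumes mono: "mono b" and cont: "continuous_on UNIV b"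
    and zero: "\<And>x. x \<le> 0 \<Longrightarrow> b x = 0"
    and "s < K"
    and dec: "\<And>i j. s \<le> i \<Longrightarrow> i \<le> j \<Longrightarrow> j < K \<Longrightarrow> b (\<psi> j - real j) \<le> b (\<psi> i - real i)"
    and grow: "\<And>j. s \<le> j \<Longrightarrow> j < K \<Longrightarrow> b (\<psi> j + 1 - real j) \<le> e j"
    and shift: "\<And>j. s \<le> j \<Longrightarrow> Suc j < K \<Longrightarrow> b (\<psi> j - real j) \<le> e (Suc j)"
  shows "\<exists>c :: nat \<Rightarrow> real. c s \<le> \<psi> s
     \<and> (\<exists>p. s < p \<and> p \<le> K \<and> (\<Sum>j=s..<p. b (c s - real j)) = (\<Sum>j=s..<p. b (\<psi> j - real j)))
     \<and> (\<forall>i j. s \<le> i \<longrightarrow> i \<le> j \<longrightarrow> j < K \<longrightarrow> c i \<le> c j \<and> b (c j - real j) \<le> b (c i - real i))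
     \<and> (\<Sum>j=s..<K. b (c j - real j)) = (\<Sum>j=s..<K. b (\<psi> j - real j))
     \<and> (\<Sum>j=s..<K. b (c j + 1 - real j)) \<le> (\<Sum>j=s..<K. e j)"
proof -
  have "\<forall>i j. s \<le> i \<longrightarrow> i \<le> j \<longrightarrow> j < K \<longrightarrow> b (\<psi> j - real j) \<le> b (\<psi> i - real i)"
    "\<forall>j. s \<le> j \<longrightarrow> j < K \<longrightarrow> b (\<psi> j + 1 - real j) \<le> e j"
    "\<forall>j. s \<le> j \<longrightarrow> Suc j < K \<longrightarrow> b (\<psi> j - real j) \<le> e (Suc j)"
    using dec grow shift by auto
  with \<open>s < K\<close> show ?thesis
  proof (induction "K - s" arbitrary: s rule: less_induct)
    case less
    note prems = less.prems(1) less.prems(2-4)[rule_format]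
    define v where "v j = b (\<psi> j - real j)" for j
    have b_nonneg: "0 \<le> b x" for x
      using zero[of 0] zero[of x] monoD[OF mono, of 0 x] by (cases "x \<le> 0") auto
    define S where "S = {c :: real. c \<le> \<psi> s} \<inter>
      (\<Inter>p\<in>{s<..K}. {c. (\<Sum>j=s..<p. b (c - real j)) \<le> (\<Sum>j=s..<p. v j)})"
    have cont_sum: "continuous_on UNIV (\<lambda>c. \<Sum>j=s..<p. b (c - real j))" for p
      by (intro continuous_intros continuous_on_compose2[OF cont]) auto
    have "closed S" unfolding S_def
      by (intro closed_Int closed_INT ballI closed_Collect_le cont_sum continuous_intros)
    moreover have "bdd_above S" by (auto simp: S_def)
    moreover have "min (\<psi> s) s \<in> S"
    proof -
      have "b (min (\<psi> s) (real s) - real j) \<le> v j" if "s \<le> j" for j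
        using that zero[of "min (\<psi> s) (real s) - real j"] b_nonneg by (simp add: v_def)
      then show ?thesis by (auto simp: S_def intro!: sum_mono)
    qed
    ultimately have "Sup S \<in> S" by (intro closed_contains_Sup) auto
    then obtain a where a_def: "a = Sup S" and "a \<in> S" by blast
    have a: "a \<le> \<psi> s" "\<And>p. s < p \<Longrightarrow> p \<le> K \<Longrightarrow> (\<Sum>j=s..<p. b (a - real j)) \<le> (\<Sum>j=s..<p. v j)"
      using \<open>a \<in> S\<close> by (auto simp: S_def)
    define T where "T = {p. s < p \<and> p \<le> K \<and> (\<Sum>j=s..<p. b (a - real j)) = (\<Sum>j=s..<p. v j)}"
    \<comment> \<open>Without equality on any initial segment, the constant \<open>a\<close> could be increased.\<close>
    have "T \<noteq> {}"
    proof
      assume "T = {}"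
      then have strict: "(\<Sum>j=s..<p. b (a - real j)) < (\<Sum>j=s..<p. v j)" if "s < p" "p \<le> K" for p
        using a(2)[OF that] that by (auto simp: T_def less_le)
      from strict[of "Suc s"] have "a \<noteq> \<psi> s" using prems by (auto simp: v_def)
      then have "a < \<psi> s" using a(1) by simp
      have "\<forall>\<^sub>F c in at_right a. \<forall>p\<in>{s<..K}. (\<Sum>j=s..<p. b (c - real j)) < (\<Sum>j=s..<p. v j)"
      proof (intro eventually_ball_finite ballI)
        fix p assume p: "p \<in> {s<..K}"
        have "isCont (\<lambda>c. \<Sum>j=s..<p. b (c - real j)) a"
          using cont_sum[of p] by (simp add: continuous_on_eq_continuous_at)
        then have "((\<lambda>c. \<Sum>j=s..<p. b (c - real j)) \<longlongrightarrow> (\<Sum>j=s..<p. b (a - real j))) (at_right a)"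
          by (simp add: isCont_def filterlim_at_split)
        then show "\<forall>\<^sub>F c in at_right a. (\<Sum>j=s..<p. b (c - real j)) < (\<Sum>j=s..<p. v j)"
          using strict[of p] p by (intro order_tendstoD(2)) auto
      qed auto
      moreover have "\<forall>\<^sub>F c in at_right a. c \<in> {a<..<\<psi> s}"
        using \<open>a < \<psi> s\<close> by (rule eventually_at_right_real)
      ultimately have "\<forall>\<^sub>F c in at_right a. a < c \<and> c \<in> S"
        by eventually_elim (auto simp: S_def less_imp_le)
      then obtain c where "a < c" "c \<in> S"
        using eventually_happens trivial_limit_at_right_real by blast
      then show False using cSup_upper[OF \<open>c \<in> S\<close> \<open>bdd_above S\<close>] by (simp add: a_def)
    qed
    moreover have "finite T" by (rule finite_subset[of _ "{..K}"]) (auto simp: T_def)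
    ultimately have p_in: "Max T \<in> T" and p_max: "\<And>q. q \<in> T \<Longrightarrow> q \<le> Max T" by auto
    define p where "p = Max T"
    have p: "s < p" "p \<le> K" "(\<Sum>j=s..<p. b (a - real j)) = (\<Sum>j=s..<p. v j)"
      using p_in by (auto simp: T_def p_def)
    obtain p' where p': "p = Suc p'" "s \<le> p'" using p(1) by (cases p) auto
    have last: "v p' \<le> b (a - real p')"
    proof (cases "p' = s")
      case False
      then show ?thesis using a(2)[of p'] p p' by simp
    next
      case True
      then show ?thesis using p p' by simp
    qed
    \<comment> \<open>Within the block, \<open>e\<close> is bounded by the slices below, except at its start.\<close>
    have head: "(\<Sum>j=s..<p. b (a + 1 - real j)) \<le> (\<Sum>j=s..<p. e j)"
    proof -
      have split_head: "(\<Sum>j=s..<p. g j) = g s + (\<Sum>j=s..<p'. g (Suc j))" for g :: "nat \<Rightarrow> real"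
        unfolding p'(1) using sum.atLeast_Suc_lessThan[OF le_imp_less_Suc[OF p'(2)], of g]
        by (simp only: sum.shift_bounds_Suc_ivl)
      have "(\<Sum>j=s..<p. b (a + 1 - real j)) = b (a + 1 - real s) + (\<Sum>j=s..<p'. b (a - real j))"
        unfolding split_head by (simp add: algebra_simps)
      also have "(\<Sum>j=s..<p'. b (a - real j)) = (\<Sum>j=s..<p. v j) - b (a - real p')"
        using p p' by simp
      also have "\<dots> \<le> (\<Sum>j=s..<p'. v j)" using last p' by simp
      also have "\<dots> \<le> (\<Sum>j=s..<p'. e (Suc j))"
        unfolding v_def using p p' by (intro sum_mono prems) auto
      also have "b (a + 1 - real s) \<le> e s"
        using prems(3)[of s] prems(1) monoD[OF mono, of "a + 1 - s" "\<psi> s + 1 - s"] a(1) by auto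
      finally show ?thesis unfolding split_head by simp
    qed
    have tail_mono: "b (a - real j) \<le> b (a - real i)" if "i \<le> j" for i j :: nat
      using that by (intro monoD[OF mono]) auto
    show ?case
    proof (cases "p = K")
      case True
      then show ?thesis using p a head tail_mono
        by (intro exI[of _ "\<lambda>_. a"]) (auto simp: v_def)
    next
      case False
      then have "p < K" using p by simp
      have sub: "K - p < K - s" "p < K"
        "\<forall>i j. p \<le> i \<longrightarrow> i \<le> j \<longrightarrow> j < K \<longrightarrow> b (\<psi> j - real j) \<le> b (\<psi> i - real i)"
        "\<forall>j. p \<le> j \<longrightarrow> j < K \<longrightarrow> b (\<psi> j + 1 - real j) \<le> e j"
        "\<forall>j. p \<le> j \<longrightarrow> Suc j < K \<longrightarrow> b (\<psi> j - real j) \<le> e (Suc j)"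
        using less.prems p \<open>p < K\<close> by auto
      from less.hyps[OF sub] obtain c :: "nat \<Rightarrow> real" where c: "c p \<le> \<psi> p"
        "\<exists>q. p < q \<and> q \<le> K \<and> (\<Sum>j=p..<q. b (c p - real j)) = (\<Sum>j=p..<q. b (\<psi> j - real j))"
        "\<And>i j. p \<le> i \<Longrightarrow> i \<le> j \<Longrightarrow> j < K \<Longrightarrow> c i \<le> c j \<and> b (c j - real j) \<le> b (c i - real i)"
        "(\<Sum>j=p..<K. b (c j - real j)) = (\<Sum>j=p..<K. b (\<psi> j - real j))"
        "(\<Sum>j=p..<K. b (c j + 1 - real j)) \<le> (\<Sum>j=p..<K. e j)"
        by (elim exE conjE) (rule that, auto)
      have split_at: "(\<Sum>j=s..<q. g j) = (\<Sum>j=s..<p. g j) + (\<Sum>j=p..<q. g j)" if "p \<le> q"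
        for q and g :: "nat \<Rightarrow> real"
        using that p by (simp add: sum.atLeastLessThan_concat)
      have "a \<le> c p"
      proof (rule ccontr)
        assume "\<not> a \<le> c p"
        from c(2) obtain q where q: "p < q" "q \<le> K" "(\<Sum>j=p..<q. b (c p - real j)) = (\<Sum>j=p..<q. v j)"
          by (auto simp: v_def)
        have "(\<Sum>j=p..<q. b (c p - real j)) \<le> (\<Sum>j=p..<q. b (a - real j))"
          using \<open>\<not> a \<le> c p\<close> by (intro sum_mono monoD[OF mono]) auto
        then have "(\<Sum>j=s..<q. v j) \<le> (\<Sum>j=s..<q. b (a - real j))"
          using q p by (simp add: split_at[of q])
        with a(2)[of q] q p have "q \<in> T" by (simp add: T_def)
        with p_max[of q] q show False by (simp add: p_def)
      qed
      have "b (c p - real p) \<le> b (\<psi> p - real p)" using c(1) by (intro monoD[OF mono]) auto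
      also have "\<dots> \<le> v p'" unfolding v_def using p p' \<open>p < K\<close> by (intro prems) auto
      also note last
      finally have join: "b (c p - real p) \<le> b (a - real p')" .
      define c' where "c' j = (if j < p then a else c j)" for j
      have "c' i \<le> c' j \<and> b (c' j - real j) \<le> b (c' i - real i)" if ij: "s \<le> i" "i \<le> j" "j < K" for i j
      proof -
        consider "j < p" | "i < p" "p \<le> j" | "p \<le> i" using ij by linarith
        then show ?thesis
        proof cases
          case 2
          have "c p \<le> c j" "b (c j - real j) \<le> b (c p - real p)" using c(3)[of p j] 2 ij by auto
          moreover have "b (a - real p') \<le> b (a - real i)" using 2 p' by (intro tail_mono) auto
          ultimately show ?thesis using 2 join \<open>a \<le> c p\<close> by (simp add: c'_def)
        qed (use ij c(3)[of i j] tail_mono in \<open>auto simp: c'_def\<close>)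
      qed
      moreover have "c' s = a" using p by (simp add: c'_def)
      moreover have "(\<Sum>j=s..<K. b (c' j - real j)) = (\<Sum>j=s..<K. b (\<psi> j - real j))"
        "(\<Sum>j=s..<K. b (c' j + 1 - real j)) \<le> (\<Sum>j=s..<K. e j)"
        using c(4,5) head p \<open>p < K\<close> by (auto simp: split_at[of K] c'_def v_def)
      ultimately show ?thesis using a(1) p
        by (intro exI[of _ c'] conjI exI[of _ p]) (auto simp: v_def)
    qed
  qed
qed

text \<open>Once the profile \<open>c\<close> is increasing, it crosses the constant profile \<open>t\<close> only once: below the
  crossing its slices are smaller than those of the simplex, above it they are larger. Since the
  slices get smaller with height, volume is shifted from larger slices to smaller ones, and by
  concavity of the growth (\<open>conc\<close>) this can only enlarge the neighbourhood.\<close>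

lemma profile_step:
  fixes b :: "real \<Rightarrow> real" and \<psi> e :: "nat \<Rightarrow> real" and t :: real
  assumes mono: "mono b" and cont: "continuous_on UNIV b"
    and zero: "\<And>x. x \<le> 0 \<Longrightarrow> b x = 0"
    and conc: "\<And>p q r s. p \<le> q \<Longrightarrow> q \<le> r \<Longrightarrow> r \<le> s \<Longrightarrow>
        (b q - b p) * (b (s + 1) - b (r + 1)) \<le> (b (q + 1) - b (p + 1)) * (b s - b r)"
    and dec: "\<And>i j. i \<le> j \<Longrightarrow> j < K \<Longrightarrow> b (\<psi> j - real j) \<le> b (\<psi> i - real i)"
    and grow: "\<And>j. j < K \<Longrightarrow> b (\<psi> j + 1 - real j) \<le> e j"
    and shift: "\<And>j. Suc j < K \<Longrightarrow> b (\<psi> j - real j) \<le> e (Suc j)"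
    and vol: "(\<Sum>j<K. b (t - real j)) < (\<Sum>j<K. b (\<psi> j - real j))"
  shows "(\<Sum>j<K. b (t + 1 - real j)) \<le> (\<Sum>j<K. e j)"
proof -
  have "0 < K" using vol by (cases K) auto
  from isotonic_regression[OF mono cont zero this, of \<psi> e] dec grow shift
  obtain c :: "nat \<Rightarrow> real" where
    c: "\<And>i j. i \<le> j \<Longrightarrow> j < K \<Longrightarrow> c i \<le> c j \<and> b (c j - real j) \<le> b (c i - real i)"
    and c_vol: "(\<Sum>j<K. b (c j - real j)) = (\<Sum>j<K. b (\<psi> j - real j))"
    and c_e: "(\<Sum>j<K. b (c j + 1 - real j)) \<le> (\<Sum>j<K. e j)"
    by (auto simp: lessThan_atLeast0)
  define L R where "L = {j. j < K \<and> c j < t}" and "R = {j. j < K \<and> \<not> c j < t}"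
  have fin: "finite L" "finite R" and part: "{..<K} = L \<union> R" "L \<inter> R = {}"
    by (auto simp: L_def R_def)
  have split: "(\<Sum>j<K. g j) = sum g L + sum g R" for g :: "nat \<Rightarrow> real"
    unfolding part(1) by (rule sum.union_disjoint[OF fin part(2)])
  define l r l' r' where "l = (\<Sum>j\<in>L. b (t - real j) - b (c j - real j))"
    and "r = (\<Sum>j\<in>R. b (c j - real j) - b (t - real j))"
    and "l' = (\<Sum>j\<in>L. b (t + 1 - real j) - b (c j + 1 - real j))"
    and "r' = (\<Sum>j\<in>R. b (c j + 1 - real j) - b (t + 1 - real j))"
  \<comment> \<open>Growth lost at the height \<open>i\<close> below the crossing against growth won at the height \<open>j\<close>
    above it, each relative to the volume lost or won.\<close>
  have pair: "(b (t + 1 - real i) - b (c i + 1 - real i)) * (b (c j - real j) - b (t - real j))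
      \<le> (b (t - real i) - b (c i - real i)) * (b (c j + 1 - real j) - b (t + 1 - real j))"
    if i: "i \<in> L" and j: "j \<in> R" for i j
  proof -
    define x y x' y' where x_y_def: "x = c i - real i" "y = t - real i" "x' = c j - real j" "y' = t - real j"
    have ij: "i < j" using i j c[of j i] by (force simp: L_def R_def not_less)
    have o: "x \<le> y" "y' \<le> x'" "y' < y" "b x' \<le> b x"
      using i j ij c[of i j] by (auto simp: x_y_def L_def R_def)
    have bo: "b x \<le> b y" "b y' \<le> b x'" "b (x + 1) \<le> b (y + 1)" "b (y' + 1) \<le> b (x' + 1)"
      using o by (auto intro!: monoD[OF mono])
    have "(b (y + 1) - b (x + 1)) * (b x' - b y') \<le> (b y - b x) * (b (x' + 1) - b (y' + 1))"
    proof -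
      consider "x < y'" | "y' \<le> x" "y < x'" | "y' \<le> x" "x' \<le> x" | "x < x'" "x' \<le> y" "y' \<le> x"
        by linarith
      then show ?thesis
      proof cases
        case 1
        then have "b x \<le> b y'" by (intro monoD[OF mono]) auto
        then have "b x' = b y'" using o bo by linarith
        then show ?thesis using bo by simp
      next
        case 2
        then have "b y \<le> b x'" by (intro monoD[OF mono]) auto
        then have eq: "b x' = b x" "b y = b x" using o bo by linarith+
        show ?thesis using conc[of y' x x y] 2 o eq by (simp add: mult.commute)
      next
        case 3
        then show ?thesis using conc[of y' x' x y] o by (simp add: mult.commute)
      next
        case 4
        \<comment> \<open>The intervals overlap in \<open>[x, x']\<close>; the contributions of the overlap to the two
          sides agree.\<close>
        show ?thesis using conc[of y' x x x'] conc[of y' x x' y] conc[of x x' x' y] 4 o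
          by (simp add: algebra_simps)
      qed
    qed
    then show ?thesis by (simp add: x_y_def algebra_simps)
  qed
  have "l < r" using vol c_vol by (simp add: l_def r_def split sum_subtractf)
  have "0 \<le> l" "0 \<le> r'" unfolding l_def r'_def
    by (intro sum_nonneg; force simp: L_def R_def intro!: monoD[OF mono])+
  have "l' * r \<le> l * r'" unfolding l'_def r_def l_def r'_def sum_product
    by (intro sum_mono pair)
  also have "\<dots> \<le> r' * r" using \<open>l < r\<close> \<open>0 \<le> r'\<close> mult_right_mono[of l r r'] by (simp add: mult.commute)
  finally have "l' \<le> r'" using \<open>0 \<le> l\<close> \<open>l < r\<close> by (simp add: mult_le_cancel_right)
  then have "(\<Sum>j<K. b (t + 1 - real j)) \<le> (\<Sum>j<K. b (c j + 1 - real j))"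
    by (simp add: l'_def r'_def split sum_subtractf)
  with c_e show ?thesis by simp
qed

section \<open>The isoperimetric inequality in the grid\<close>

definition grid :: "nat \<Rightarrow> nat \<Rightarrow> (nat \<Rightarrow> nat) set" where
  "grid n K = {..<n} \<rightarrow>\<^sub>E {..<K}"

lemma finite_grid [simp]: "finite (grid n K)"
  by (simp add: grid_def finite_PiE)

lemma card_grid: "card (grid n K) = K ^ n"
  by (simp add: grid_def card_PiE)

lemma grid_update_less: "x \<in> grid n K \<Longrightarrow> i < n \<Longrightarrow> a < K \<Longrightarrow> x(i := a) \<in> grid n K"
  by (auto simp: grid_def PiE_iff extensional_def)

lemma grid_update_Suc: "x \<in> grid n K \<Longrightarrow> a < K \<Longrightarrow> x(n := a) \<in> grid (Suc n) K"
  by (auto simp: grid_def PiE_iff extensional_def less_Suc_eq)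

lemma sum_grid_Suc:
  fixes f :: "(nat \<Rightarrow> nat) \<Rightarrow> real"
  shows "(\<Sum>x\<in>grid (Suc n) K. f x) = (\<Sum>j<K. \<Sum>x\<in>grid n K. f (x(n := j)))"
proof -
  have bij: "bij_betw (\<lambda>(j, x). x(n := j)) ({..<K} \<times> grid n K) (grid (Suc n) K)"
    unfolding bij_betw_def grid_def lessThan_Suc
  proof
    show "inj_on (\<lambda>(j, x). x(n := j)) ({..<K} \<times> ({..<n} \<rightarrow>\<^sub>E {..<K}))"
      by (rule inj_combinator) simp
    show "(\<lambda>(j, x). x(n := j)) ` ({..<K} \<times> ({..<n} \<rightarrow>\<^sub>E {..<K})) = insert n {..<n} \<rightarrow>\<^sub>E {..<K}"
      by (simp add: PiE_insert_eq)
  qed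
  have "(\<Sum>x\<in>grid (Suc n) K. f x) = (\<Sum>(j, x)\<in>{..<K} \<times> grid n K. f (x(n := j)))"
    by (subst sum.reindex_bij_betw[OF bij, symmetric]) (simp add: case_prod_unfold)
  then show ?thesis by (simp add: sum.cartesian_product)
qed

lemma simplex_vol_eq_sum:
  "simplex_vol K n t = (\<Sum>x\<in>grid n K. max 0 (min 1 (t - real (\<Sum>i<n. x i))))"
proof (induction n arbitrary: t)
  case 0
  show ?case by (simp add: grid_def)
next
  case (Suc n)
  have "(\<Sum>i<Suc n. (x(n := j)) i) = (\<Sum>i<n. x i) + j" for x :: "nat \<Rightarrow> nat" and j
    by simp
  then show ?case unfolding sum_grid_Suc simplex_vol.simps(2) Suc
    by (simp add: algebra_simps)
qed

text \<open>For integer parameters the interpolation is invisible. The size \<open>t + 1\<close> is the one at which the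
  points with coordinate sum \<open>t\<close> are completely filled.\<close>

lemma simplex_vol_Suc_nat:
  "simplex_vol K n (real t + 1) = real (card {x \<in> grid n K. (\<Sum>i<n. x i) \<le> t})"
proof -
  have "max 0 (min 1 (real t + 1 - real s)) = (if s \<le> t then 1 else 0)" for s
    by auto
  then show ?thesis unfolding simplex_vol_eq_sum
    by (simp add: sum.If_cases Int_def del: of_nat_sum)
qed

text \<open>The functions \<open>f\<close> and \<open>g\<close> are fractional sets, and the hypotheses \<open>fill\<close> and \<open>spread\<close> say that
  \<open>g\<close> contains the neighbourhood of \<open>f\<close> of radius one: a partially filled point becomes full, and a
  point inherits the filling of its lower neighbours. By the induction hypothesis, the slices of
  \<open>f\<close> can be replaced by simplices of the same volumes without enlarging the neighbourhoods of
  the slices, and what remains is a one-dimensional problem. Replacing slices separately is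
  harmless because simplices are nested, so that the union of two of them is the larger one.

  The strict inequality in \<open>vol\<close> excludes \<open>f = 0\<close>, whose neighbourhood is empty although a simplex of
  size zero has a neighbourhood of positive volume.\<close>

lemma grid_isoperimetry_strict:
  fixes f g :: "(nat \<Rightarrow> nat) \<Rightarrow> real"
  assumes "K \<ge> 1"
    and range: "\<And>x. x \<in> grid n K \<Longrightarrow> 0 \<le> f x \<and> f x \<le> 1 \<and> 0 \<le> g x"
    and antimono: "\<And>x i. x \<in> grid n K \<Longrightarrow> i < n \<Longrightarrow> Suc (x i) < K \<Longrightarrow> f (x(i := Suc (x i))) \<le> f x"
    and fill: "\<And>x. x \<in> grid n K \<Longrightarrow> 0 < f x \<Longrightarrow> 1 \<le> g x"
    and spread: "\<And>x i. x \<in> grid n K \<Longrightarrow> i < n \<Longrightarrow> Suc (x i) < K \<Longrightarrow> f x \<le> g (x(i := Suc (x i)))"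
    and vol: "simplex_vol K n t < (\<Sum>x\<in>grid n K. f x)"
  shows "simplex_vol K n (t + 1) \<le> (\<Sum>x\<in>grid n K. g x)"
  using range antimono fill spread vol
proof (induction n arbitrary: f g t)
  case 0
  then have "1 \<le> g (\<lambda>_. undefined)" by (auto simp: grid_def)
  then show ?case by (simp add: grid_def)
next
  case (Suc n)
  define b where "b = simplex_vol K n"
  define v where "v j = (\<Sum>x\<in>grid n K. f (x(n := j)))" for j
  define e where "e j = (\<Sum>x\<in>grid n K. g (x(n := j)))" for j
  have mono: "mono b" by (auto simp: b_def mono_def simplex_vol_mono)
  have cont: "continuous_on UNIV b" by (simp add: b_def continuous_simplex_vol)
  have zero: "b x = 0" if "x \<le> 0" for x using that by (simp add: b_def simplex_vol_nonpos)
  have v0: "0 \<le> v j" "v j \<le> real K ^ n" "0 \<le> e j" if "j < K" for j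
  proof -
    have "v j \<le> (\<Sum>x\<in>grid n K. 1)"
      unfolding v_def using Suc.prems(1)[OF grid_update_Suc] that by (intro sum_mono) blast
    then show "v j \<le> real K ^ n" by (simp add: card_grid)
    show "0 \<le> v j" "0 \<le> e j"
      unfolding v_def e_def using Suc.prems(1)[OF grid_update_Suc] that by (blast intro: sum_nonneg)+
  qed
  have v_Suc: "v (Suc j) \<le> v j" "v j \<le> e (Suc j)" if "Suc j < K" for j
  proof -
    have "f (x(n := Suc j)) \<le> f (x(n := j)) \<and> f (x(n := j)) \<le> g (x(n := Suc j))"
      if "x \<in> grid n K" for x
      using Suc.prems(2,4)[OF grid_update_Suc[OF that], of j n] \<open>Suc j < K\<close>
      by (simp del: fun_upd_apply add: fun_upd_same)
    then show "v (Suc j) \<le> v j" "v j \<le> e (Suc j)"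
      unfolding v_def e_def by (blast intro: sum_mono)+
  qed
  have v_dec: "v j \<le> v i" if "i \<le> j" "j < K" for i j
    using that
  proof (induction j rule: dec_induct)
    case (step k)
    then show ?case using v_Suc(1)[of k] by simp
  qed simp
  have layer: "b (s + 1) \<le> e j" if "j < K" "b s < v j" for s j
    unfolding b_def e_def
  proof (rule Suc.IH)
    show "simplex_vol K n s < (\<Sum>x\<in>grid n K. f (x(n := j)))"
      using that by (simp add: b_def v_def)
  next
    fix x i assume x: "x \<in> grid n K" "i < n" "Suc (x i) < K"
    then have eq: "(x(n := j))(i := Suc ((x(n := j)) i)) = x(i := Suc (x i), n := j)" by auto
    show "f (x(i := Suc (x i), n := j)) \<le> f (x(n := j))"
      "f (x(n := j)) \<le> g (x(i := Suc (x i), n := j))"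
      using Suc.prems(2,4)[OF grid_update_Suc[OF x(1) that(1)], of i, unfolded eq] x
      by (simp_all del: fun_upd_apply add: fun_upd_other)
  next
    fix x assume x: "x \<in> grid n K"
    from x that(1) have "x(n := j) \<in> grid (Suc n) K" by (rule grid_update_Suc)
    from Suc.prems(1,3)[OF this]
    show "0 \<le> f (x(n := j)) \<and> f (x(n := j)) \<le> 1 \<and> 0 \<le> g (x(n := j))"
      "0 < f (x(n := j)) \<Longrightarrow> 1 \<le> g (x(n := j))" by blast+
  qed
  have "\<exists>\<phi>. b \<phi> = v j \<and> b (\<phi> + 1) \<le> e j" if j: "j < K" for j
  proof (cases "v j = 0")
    case True
    \<comment> \<open>An empty slice stays empty; the simplex of size \<open>-1\<close> also is empty after growing.\<close>
    then show ?thesis using v0[OF j] zero by (intro exI[of _ "-1"]) auto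
  next
    case False
    then have pos: "0 < v j" using v0[OF j] by simp
    define A where "A = {x. b x < v j}"
    define \<phi> where "\<phi> = Sup A"
    have "0 \<in> A" using pos zero[of 0] by (simp add: A_def)
    have bdd: "bdd_above A"
    proof (rule bdd_aboveI[of _ "real (n * (K - 1)) + 1"], rule ccontr)
      fix x assume "x \<in> A" "\<not> x \<le> real (n * (K - 1)) + 1"
      then show False using simplex_vol_full[of n K x] v0[OF j] by (simp add: A_def b_def)
    qed
    have below: "b x < v j" if x: "x < \<phi>" for x
    proof -
      obtain y where "y \<in> A" "x < y" using less_cSup_iff[of A x] \<open>0 \<in> A\<close> bdd x by (auto simp: \<phi>_def)
      then show ?thesis using monoD[OF mono, of x y] by (simp add: A_def)
    qed
    have above: "v j \<le> b x" if x: "\<phi> < x" for x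
      using cSup_upper[OF _ bdd, of x] x by (force simp: A_def \<phi>_def)
    have lim: "((\<lambda>x. b (x + a)) \<longlongrightarrow> b (\<phi> + a)) (at_left \<phi>)"
      "((\<lambda>x. b (x + a)) \<longlongrightarrow> b (\<phi> + a)) (at_right \<phi>)" for a
    proof -
      have "continuous_on UNIV (\<lambda>x. b (x + a))"
        by (rule continuous_on_compose2[OF cont]) (auto intro!: continuous_intros)
      then have "isCont (\<lambda>x. b (x + a)) \<phi>"
        by (simp add: continuous_on_eq_continuous_at)
      then show "((\<lambda>x. b (x + a)) \<longlongrightarrow> b (\<phi> + a)) (at_left \<phi>)"
        "((\<lambda>x. b (x + a)) \<longlongrightarrow> b (\<phi> + a)) (at_right \<phi>)"
        by (simp_all add: isCont_def filterlim_at_split)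
    qed
    have left: "\<forall>\<^sub>F x in at_left \<phi>. x < \<phi>" by (simp add: eventually_at_filter)
    have right: "\<forall>\<^sub>F x in at_right \<phi>. \<phi> < x" by (simp add: eventually_at_filter)
    have "b \<phi> \<le> v j" using lim(1)[of 0, simplified]
      by (rule tendsto_upperbound)
         (simp_all add: eventually_mono[OF left] less_imp_le[OF below])
    moreover have "v j \<le> b \<phi>" using lim(2)[of 0, simplified]
      by (rule tendsto_lowerbound) (simp_all add: eventually_mono[OF right] above)
    moreover have "b (\<phi> + 1) \<le> e j" using lim(1)[of 1]
      by (rule tendsto_upperbound) (simp_all add: eventually_mono[OF left] layer[OF j below])
    ultimately show ?thesis by (intro exI[of _ \<phi>] conjI order_antisym)
  qed
  then obtain \<phi> where \<phi>: "\<And>j. j < K \<Longrightarrow> b (\<phi> j) = v j" "\<And>j. j < K \<Longrightarrow> b (\<phi> j + 1) \<le> e j"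
    by metis
  have "(\<Sum>j<K. b (t + 1 - real j)) \<le> (\<Sum>j<K. e j)"
  proof (rule profile_step[OF mono cont, where \<psi> = "\<lambda>j. \<phi> j + real j"])
    show "(b q - b p) * (b (s + 1) - b (r + 1)) \<le> (b (q + 1) - b (p + 1)) * (b s - b r)"
      if "p \<le> q" "q \<le> r" "r \<le> s" for p q r s
      using simplex_vol_shift_inequality[OF assms(1) that, of n 1] by (simp add: b_def)
    show "(\<Sum>j<K. b (t - real j)) < (\<Sum>j<K. b (\<phi> j + real j - real j))"
      using Suc.prems(5) by (simp add: sum_grid_Suc v_def b_def \<phi>(1)[unfolded b_def])
    show "b (\<phi> j + real j + 1 - real j) \<le> e j" if "j < K" for j
      using \<phi>(2)[OF that] by simp
    show "b (\<phi> j + real j - real j) \<le> b (\<phi> i + real i - real i)" if "i \<le> j" "j < K" for i j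
      using v_dec[OF that] that \<phi>(1)[of i] \<phi>(1)[of j] by simp
    show "b (\<phi> j + real j - real j) \<le> e (Suc j)" if "Suc j < K" for j
      using v_Suc(2)[OF that] that \<phi>(1)[of j] by simp
  qed (fact zero)
  then show ?case by (simp add: sum_grid_Suc b_def e_def)
qed

lemma grid_isoperimetry:
  fixes f g :: "(nat \<Rightarrow> nat) \<Rightarrow> real"
  assumes "K \<ge> 1"
    and range: "\<And>x. x \<in> grid n K \<Longrightarrow> 0 \<le> f x \<and> f x \<le> 1 \<and> 0 \<le> g x"
    and antimono: "\<And>x i. x \<in> grid n K \<Longrightarrow> i < n \<Longrightarrow> Suc (x i) < K \<Longrightarrow> f (x(i := Suc (x i))) \<le> f x"
    and fill: "\<And>x. x \<in> grid n K \<Longrightarrow> 0 < f x \<Longrightarrow> 1 \<le> g x"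
    and spread: "\<And>x i. x \<in> grid n K \<Longrightarrow> i < n \<Longrightarrow> Suc (x i) < K \<Longrightarrow> f x \<le> g (x(i := Suc (x i)))"
    and "0 < t" and vol: "simplex_vol K n t \<le> (\<Sum>x\<in>grid n K. f x)"
  shows "simplex_vol K n (t + 1) \<le> (\<Sum>x\<in>grid n K. g x)"
proof -
  define cap where "cap = real (n * (K - 1)) + 1"
  define t' where "t' = min t cap"
  have "0 < cap" unfolding cap_def by (rule add_nonneg_pos) auto
  have below: "simplex_vol K n s < (\<Sum>x\<in>grid n K. f x)" if "s < t'" for s
  proof -
    have "simplex_vol K n s < simplex_vol K n t'"
      using that assms(1) \<open>0 < t\<close> \<open>0 < cap\<close>
      by (intro simplex_vol_strict_mono) (auto simp: t'_def cap_def)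
    also have "\<dots> \<le> simplex_vol K n t" by (intro simplex_vol_mono) (simp add: t'_def)
    finally show ?thesis using vol by simp
  qed
  have "continuous_on UNIV (\<lambda>x. simplex_vol K n (x + 1))"
    by (rule continuous_on_compose2[OF continuous_simplex_vol]) (auto intro!: continuous_intros)
  then have "((\<lambda>x. simplex_vol K n (x + 1)) \<longlongrightarrow> simplex_vol K n (t' + 1)) (at_left t')"
    by (simp add: continuous_on_eq_continuous_at isCont_def filterlim_at_split)
  moreover have "\<forall>\<^sub>F s in at_left t'. simplex_vol K n (s + 1) \<le> (\<Sum>x\<in>grid n K. g x)"
    unfolding eventually_at_filter
  proof (intro always_eventually allI impI)
    fix s assume "s \<in> {..<t'}"
    then have "s < t'" by simp
    show "simplex_vol K n (s + 1) \<le> (\<Sum>x\<in>grid n K. g x)"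
      by (rule grid_isoperimetry_strict[OF assms(1)])
         (fact range antimono fill spread below[OF \<open>s < t'\<close>])+
  qed
  ultimately have "simplex_vol K n (t' + 1) \<le> (\<Sum>x\<in>grid n K. g x)"
    by (rule tendsto_upperbound) auto
  moreover have "simplex_vol K n (t + 1) = simplex_vol K n (t' + 1)"
  proof (cases "t \<le> cap")
    case False
    have "simplex_vol K n (u + 1) = real K ^ n" if "cap \<le> u" for u
      using that by (intro simplex_vol_full) (simp add: cap_def)
    from this[of t] this[of t'] show ?thesis using False by (simp add: t'_def)
  qed (simp add: t'_def)
  ultimately show ?thesis by simp
qed

definition l1_nbhd :: "nat \<Rightarrow> nat \<Rightarrow> nat \<Rightarrow> (nat \<Rightarrow> nat) set \<Rightarrow> (nat \<Rightarrow> nat) set" where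
  "l1_nbhd n K m D = {x \<in> grid n K. \<exists>y\<in>D. (\<Sum>i<n. nat \<bar>int (x i) - int (y i)\<bar>) \<le> m}"

text \<open>For a set that is closed under decreasing coordinates, iterating the step for radius one.\<close>

lemma grid_downset_isoperimetry:
  assumes "K \<ge> 1" "D \<subseteq> grid n K"
    and down: "\<And>x i j. x \<in> D \<Longrightarrow> i < n \<Longrightarrow> j \<le> x i \<Longrightarrow> x(i := j) \<in> D"
    and "0 < t" "simplex_vol K n t \<le> real (card D)"
  shows "simplex_vol K n (t + real m) \<le> real (card (l1_nbhd n K m D))"
proof -
  define N where "N m = l1_nbhd n K m D" for m
  have N_grid: "N m \<subseteq> grid n K" for m by (auto simp: N_def l1_nbhd_def)
  have N_down: "x(i := j) \<in> N m" if x: "x \<in> N m" "i < n" "j \<le> x i" for x i j m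
  proof -
    obtain y where y: "y \<in> D" "(\<Sum>i<n. nat \<bar>int (x i) - int (y i)\<bar>) \<le> m"
      using x by (auto simp: N_def l1_nbhd_def)
    have "y(i := min j (y i)) \<in> D" using down y x by simp
    moreover have "(\<Sum>l<n. nat \<bar>int ((x(i := j)) l) - int ((y(i := min j (y i))) l)\<bar>)
        \<le> (\<Sum>i<n. nat \<bar>int (x i) - int (y i)\<bar>)"
      using x by (intro sum_mono) (auto simp: min_def)
    moreover have "x \<in> grid n K" using N_grid[of m] x by blast
    moreover from this have "x i < K" using x(2) by (auto simp: grid_def)
    ultimately have "x(i := j) \<in> grid n K" "y(i := min j (y i)) \<in> D"
        "(\<Sum>l<n. nat \<bar>int ((x(i := j)) l) - int ((y(i := min j (y i))) l)\<bar>) \<le> m"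
      using x y(2) by (auto intro!: grid_update_less)
    then show ?thesis by (auto simp: N_def l1_nbhd_def simp del: fun_upd_apply)
  qed
  have N_spread: "x(i := Suc (x i)) \<in> N (Suc m)" if x: "x \<in> N m" "i < n" "Suc (x i) < K" for x i m
  proof -
    obtain y where y: "y \<in> D" "(\<Sum>i<n. nat \<bar>int (x i) - int (y i)\<bar>) \<le> m"
      using x by (auto simp: N_def l1_nbhd_def)
    have "(\<Sum>l<n. nat \<bar>int ((x(i := Suc (x i))) l) - int (y l)\<bar>)
        \<le> (\<Sum>l<n. nat \<bar>int (x l) - int (y l)\<bar> + (if l = i then 1 else 0))"
      by (intro sum_mono) auto
    also have "\<dots> \<le> Suc m" using y x by (simp add: sum.distrib)
    finally show ?thesis using y x N_grid[of m]
      by (auto simp: N_def l1_nbhd_def intro: grid_update_less)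
  qed
  have N_Suc: "N m \<subseteq> N (Suc m)" for m by (auto simp: N_def l1_nbhd_def intro: le_SucI)
  have card_eq: "(\<Sum>x\<in>grid n K. indicator A x) = real (card A)" if "A \<subseteq> grid n K" for A
    using that by (simp add: indicator_def sum.If_cases Int_absorb1)
  have "simplex_vol K n (t + real m) \<le> real (card (N m))"
  proof (induction m)
    case 0
    have "D \<subseteq> N 0" using assms(2) by (auto simp: N_def l1_nbhd_def intro!: bexI)
    then have "card D \<le> card (N 0)"
      using N_grid[of 0] finite_subset[OF _ finite_grid] by (intro card_mono) auto
    then show ?case using assms by simp
  next
    case (Suc m)
    have "simplex_vol K n (t + real m + 1) \<le> (\<Sum>x\<in>grid n K. indicator (N (Suc m)) x)"
    proof (rule grid_isoperimetry[OF assms(1), where f = "indicator (N m)"])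
      fix x i assume x: "x \<in> grid n K" "i < n" "Suc (x i) < K"
      show "indicator (N m) (x(i := Suc (x i))) \<le> (indicator (N m) x :: real)"
        using N_down[of "x(i := Suc (x i))" m i "x i"] x by (auto simp: indicator_def)
      show "indicator (N m) x \<le> (indicator (N (Suc m)) (x(i := Suc (x i))) :: real)"
        using N_spread[of x m i] x by (auto simp: indicator_def)
    next
      fix x assume "0 < (indicator (N m) x :: real)"
      then show "1 \<le> (indicator (N (Suc m)) x :: real)"
        using N_Suc[of m] by (auto simp: indicator_def split: if_splits)
    next
      show "simplex_vol K n (t + real m) \<le> (\<Sum>x\<in>grid n K. indicator (N m) x)"
        using Suc by (simp add: card_eq[OF N_grid])
    qed (use \<open>0 < t\<close> in auto)
    then show ?case by (simp add: card_eq[OF N_grid] add_ac)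
  qed
  then show ?thesis by (simp add: N_def)
qed

section \<open>Compression of subsets of the discrete torus\<close>

definition circ_gap :: "nat \<Rightarrow> nat \<Rightarrow> nat \<Rightarrow> nat" where
  "circ_gap K a b = nat (min ((int a - int b) mod int K) ((int b - int a) mod int K))"

text \<open>The distance of \<open>a\<close> and \<open>b\<close> in steps of length two, rounded up. An arc in the cycle grows at both
  ends, that is, its size grows by two per step. Rearranging it to the initial segment \<open>{..<s}\<close>
  of the same size, growth is at the upper end only, but at the same rate with respect
  to this distance.\<close>

definition chain_gap :: "nat \<Rightarrow> nat \<Rightarrow> nat" where
  "chain_gap a b = (nat \<bar>int a - int b\<bar> + 1) div 2"

lemma circ_gap_le_iff:
  assumes "K > 0"
  shows "circ_gap K a b \<le> m \<longleftrightarrow> (\<exists>d. \<bar>d\<bar> \<le> int m \<and> int a mod int K = (int b + d) mod int K)"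
proof
  assume "circ_gap K a b \<le> m"
  then consider "(int a - int b) mod int K \<le> int m" | "(int b - int a) mod int K \<le> int m"
    by (auto simp: circ_gap_def min_def split: if_splits)
  then show "\<exists>d. \<bar>d\<bar> \<le> int m \<and> int a mod int K = (int b + d) mod int K"
  proof cases
    case 1
    then show ?thesis using assms
      by (intro exI[of _ "(int a - int b) mod int K"]) (simp add: mod_add_right_eq)
  next
    case 2
    have "(int b + - ((int b - int a) mod int K)) mod int K = (int b - (int b - int a)) mod int K"
      by (simp add: mod_diff_right_eq)
    with 2 show ?thesis using assms
      by (intro exI[of _ "- ((int b - int a) mod int K)"]) simp
  qed
next
  assume "\<exists>d. \<bar>d\<bar> \<le> int m \<and> int a mod int K = (int b + d) mod int K"
  then obtain d where d: "\<bar>d\<bar> \<le> int m" "int a mod int K = (int b + d) mod int K" by blast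
  have "(int a - int b) mod int K = (int a mod int K - int b) mod int K"
    "(int b - int a) mod int K = (int b - int a mod int K) mod int K"
    by (simp_all add: mod_diff_left_eq mod_diff_right_eq)
  then have e: "(int a - int b) mod int K = d mod int K" "(int b - int a) mod int K = (- d) mod int K"
    unfolding d(2) by (simp_all add: mod_diff_left_eq mod_diff_right_eq)
  show "circ_gap K a b \<le> m"
  proof (cases "0 \<le> d")
    case True
    then have "d mod int K \<le> d" by (rule zmod_le_nonneg_dividend)
    then have "d mod int K \<le> int m" using d(1) by linarith
    then show ?thesis by (simp add: circ_gap_def e min_le_iff_disj nat_le_iff)
  next
    case False
    then have "(- d) mod int K \<le> - d" by (intro zmod_le_nonneg_dividend) simp
    then have "(- d) mod int K \<le> int m" using d(1) by linarith
    then show ?thesis by (simp add: circ_gap_def e min_le_iff_disj nat_le_iff)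
  qed
qed

lemma shift_invariant_eq_all:
  fixes T :: "nat set"
  assumes "T \<subseteq> {..<K}" "T \<noteq> {}" and inv: "\<And>a. a \<in> T \<Longrightarrow> (a + 1) mod K \<in> T"
  shows "T = {..<K}"
proof
  obtain a where a: "a \<in> T" using assms by blast
  have "(a + j) mod K \<in> T" for j
  proof (induction j)
    case 0
    then show ?case using a assms by (simp add: subset_eq)
  next
    case (Suc j)
    then show ?case using inv[OF Suc] by (simp add: mod_Suc_eq)
  qed
  moreover have "(a + (K - a + c)) mod K = c" if "c < K" for c
    using that a assms(1) by (auto simp: subset_eq)
  ultimately show "{..<K} \<subseteq> T" by (metis lessThan_iff subsetI)
qed fact

text \<open>A nonempty proper subset \<open>S\<close> of the cycle has a successor and a predecessor outside of itself. If
  there is room in \<open>T\<close> for one new point \<open>x\<close> only, both of them are \<open>x\<close>, whose own successor is then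
  in \<open>S\<close>; so \<open>T\<close> is invariant under the rotation
  and hence the whole cycle.\<close>

lemma card_circ_step:
  fixes S T :: "nat set"
  assumes "K > 0" "S \<subseteq> {..<K}" "S \<noteq> {}" "S \<subseteq> T" "T \<subseteq> {..<K}"
    and up: "\<And>a. a \<in> S \<Longrightarrow> (a + 1) mod K \<in> T"
    and dn: "\<And>a. a < K \<Longrightarrow> (a + 1) mod K \<in> S \<Longrightarrow> a \<in> T"
  shows "min K (card S + 2) \<le> card T"
proof (rule ccontr)
  assume "\<not> min K (card S + 2) \<le> card T"
  then have less: "card T < K" "card T \<le> card S + 1" by auto
  have fin: "finite T" "finite S"
    using finite_subset[OF assms(5)] finite_subset[OF assms(2)] by simp_all
  have not_all: "X \<noteq> {..<K}" if "X \<subseteq> T" for X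
    using less(1) card_mono[OF fin(1) that] by auto
  have inj: "inj_on (\<lambda>a. (a + 1) mod K) {..<K}"
  proof (rule inj_onI)
    fix a b assume "a \<in> {..<K}" "b \<in> {..<K}" "(a + 1) mod K = (b + 1) mod K"
    then show "a = b" by (auto simp: mod_Suc split: if_splits)
  qed
  obtain y where y: "y \<in> S" "(y + 1) mod K \<notin> S"
    using shift_invariant_eq_all[of S K] assms not_all[of S] by blast
  define x where "x = (y + 1) mod K"
  have "insert x S \<subseteq> T" using up y assms by (auto simp: x_def)
  moreover have "card (insert x S) = card S + 1" using y fin by (simp add: x_def)
  ultimately have T: "T = insert x S" using less(2) fin card_subset_eq[of T "insert x S"]
    by (metis card_mono le_antisym)
  have "\<exists>w<K. w \<notin> S \<and> (w + 1) mod K \<in> S"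
  proof (rule ccontr)
    assume *: "\<not> ?thesis"
    have "S \<subseteq> (\<lambda>a. (a + 1) mod K) ` S"
    proof
      fix s assume "s \<in> S"
      then have "s < K" using assms by auto
      define w where "w = (if s = 0 then K - 1 else s - 1)"
      have "(w + 1) mod K = s" using \<open>s < K\<close> by (simp add: w_def)
      moreover have "w < K" using \<open>s < K\<close> by (auto simp: w_def)
      ultimately show "s \<in> (\<lambda>a. (a + 1) mod K) ` S" using * \<open>s \<in> S\<close> by blast
    qed
    moreover have "card ((\<lambda>a. (a + 1) mod K) ` S) = card S"
      using inj assms(2) by (intro card_image) (rule inj_on_subset)
    ultimately have "S = (\<lambda>a. (a + 1) mod K) ` S"
      using fin by (intro card_subset_eq) auto
    then show False using y by blast
  qed
  then obtain w where w: "w < K" "w \<notin> S" "(w + 1) mod K \<in> S" by blast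
  then have "w = x" using dn[of w] T by auto
  have "T = {..<K}"
    by (rule shift_invariant_eq_all) (use assms up w \<open>w = x\<close> T in auto)
  then show False using not_all by blast
qed

lemma card_circ_nbhd:
  assumes "K > 0" "S \<subseteq> {..<K}" "S \<noteq> {}"
  shows "min K (card S + 2 * m) \<le> card {a. a < K \<and> (\<exists>b\<in>S. circ_gap K a b \<le> m)}"
proof (induction m)
  case 0
  have "S \<subseteq> {a. a < K \<and> (\<exists>b\<in>S. circ_gap K a b \<le> 0)}"
    using assms(2) by (auto simp: circ_gap_def intro!: bexI)
  then have "card S \<le> card {a. a < K \<and> (\<exists>b\<in>S. circ_gap K a b \<le> 0)}"
    by (intro card_mono) auto
  then show ?case by simp
next
  case (Suc m)
  define N where "N m = {a. a < K \<and> (\<exists>b\<in>S. circ_gap K a b \<le> m)}" for m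
  have near: "c \<in> N (Suc m)"
    if "a \<in> N m" "c < K" "\<bar>d\<bar> \<le> 1" "int c mod int K = (int a + d) mod int K" for a c d
  proof -
    from that(1) obtain b d' where b: "b \<in> S" "\<bar>d'\<bar> \<le> int m" "int a mod int K = (int b + d') mod int K"
      by (auto simp: N_def circ_gap_le_iff[OF assms(1)])
    have "int c mod int K = (int a mod int K + d) mod int K" by (simp add: that(4) mod_add_left_eq)
    also have "\<dots> = (int b + (d' + d)) mod int K" unfolding b(3) by (simp add: mod_add_left_eq add.assoc)
    finally have "circ_gap K c b \<le> Suc m"
      unfolding circ_gap_le_iff[OF assms(1)] using b(2) that(3) by (intro exI[of _ "d' + d"]) auto
    then show ?thesis using b(1) that(2) by (auto simp: N_def)
  qed
  have "min K (card (N m) + 2) \<le> card (N (Suc m))"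
  proof (rule card_circ_step[OF assms(1)])
    show "N m \<noteq> {}" using assms by (fastforce simp: N_def circ_gap_def)
    show "N m \<subseteq> N (Suc m)" by (auto simp: N_def intro: le_SucI)
    show "(a + 1) mod K \<in> N (Suc m)" if "a \<in> N m" for a
      using assms(1) by (intro near[OF that, of _ 1]) (auto simp: of_nat_mod add.commute)
    show "a \<in> N (Suc m)" if a: "a < K" "(a + 1) mod K \<in> N m" for a
    proof (rule near[OF a(2,1), of "-1"])
      have "(int ((a + 1) mod K) + - 1) mod int K = (int a + 1 - 1) mod int K"
        by (simp only: of_nat_mod of_nat_add of_nat_1 mod_diff_left_eq add_uminus_conv_diff)
      then show "int a mod int K = (int ((a + 1) mod K) + - 1) mod int K" by simp
    qed simp
  qed (auto simp: N_def)
  with Suc show ?case by (simp add: N_def)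
qed

text \<open>Coordinates are compressed one after the other: those with index below \<open>p\<close> are already
  rearranged and carry the distance of the chain, the others still that of the cycle.\<close>

definition mixed_gap :: "nat \<Rightarrow> nat \<Rightarrow> nat \<Rightarrow> nat \<Rightarrow> nat \<Rightarrow> nat" where
  "mixed_gap K p i = (if i < p then chain_gap else circ_gap K)"

definition mixed_nbhd :: "nat \<Rightarrow> nat \<Rightarrow> nat \<Rightarrow> nat \<Rightarrow> (nat \<Rightarrow> nat) set \<Rightarrow> (nat \<Rightarrow> nat) set" where
  "mixed_nbhd n K p m A = {x \<in> grid n K. \<exists>y\<in>A. (\<Sum>i<n. mixed_gap K p i (x i) (y i)) \<le> m}"

definition compress :: "nat \<Rightarrow> nat \<Rightarrow> nat \<Rightarrow> (nat \<Rightarrow> nat) set \<Rightarrow> (nat \<Rightarrow> nat) set" where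
  "compress n K p A = {x \<in> grid n K. x p < card {a. x(p := a) \<in> A}}"

lemma card_eq_sum_fibres:
  assumes "p < n" "X \<subseteq> grid n K"
  shows "card X = (\<Sum>y\<in>{..<n} - {p} \<rightarrow>\<^sub>E {..<K}. card {a. y(p := a) \<in> X})"
proof -
  have ins: "insert p ({..<n} - {p}) = {..<n}" using assms by auto
  have inj: "inj_on (\<lambda>(a, y). y(p := a)) ({..<K} \<times> ({..<n} - {p} \<rightarrow>\<^sub>E {..<K}))"
    by (rule inj_combinator) simp
  have X: "X = (\<lambda>(y, a). y(p := a)) ` (SIGMA y : {..<n} - {p} \<rightarrow>\<^sub>E {..<K}. {a. y(p := a) \<in> X})"
  proof (intro equalityI subsetI)
    fix x assume x: "x \<in> X"
    then have "x \<in> insert p ({..<n} - {p}) \<rightarrow>\<^sub>E {..<K}" using assms ins by (auto simp: grid_def)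
    then obtain a y where "y \<in> {..<n} - {p} \<rightarrow>\<^sub>E {..<K}" "x = y(p := a)"
      unfolding PiE_insert_eq by auto
    then show "x \<in> (\<lambda>(y, a). y(p := a)) ` (SIGMA y : {..<n} - {p} \<rightarrow>\<^sub>E {..<K}. {a. y(p := a) \<in> X})"
      using x by force
  qed auto
  have lt: "a < K" if "y(p := a) \<in> X" for y a
    using that assms by (force simp: grid_def PiE_iff)
  define Z where "Z = (SIGMA y : {..<n} - {p} \<rightarrow>\<^sub>E {..<K}. {a. y(p := a) \<in> X})"
  have "inj_on (\<lambda>(y, a). y(p := a)) Z"
  proof (rule inj_onI, clarify)
    fix y a y' a' assume *: "(y, a) \<in> Z" "(y', a') \<in> Z" "y(p := a) = y'(p := a')"
    then have "y(p := a) \<in> X" "y'(p := a') \<in> X" "y \<in> {..<n} - {p} \<rightarrow>\<^sub>E {..<K}" "y' \<in> {..<n} - {p} \<rightarrow>\<^sub>E {..<K}"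
      by (simp_all add: Z_def)
    moreover from this(1,2) have "a < K" "a' < K" by (blast intro: lt)+
    ultimately have "(a, y) = (a', y')"
      using *(3) by (intro inj_onD[OF inj, of "(a, y)" "(a', y')"]) (simp_all only: mem_Times_iff fst_conv snd_conv lessThan_iff prod.case)
    then show "y = y' \<and> a = a'" by simp
  qed
  then have "card ((\<lambda>(y, a). y(p := a)) ` Z) = card Z" by (rule card_image)
  moreover have "card X = card ((\<lambda>(y, a). y(p := a)) ` Z)" unfolding Z_def by (rule arg_cong[OF X])
  ultimately have "card X = card Z" by simp
  also have "\<dots> = (\<Sum>y\<in>{..<n} - {p} \<rightarrow>\<^sub>E {..<K}. card {a. y(p := a) \<in> X})"
    unfolding Z_def
  proof (rule card_SigmaI)
    show "finite ({..<n} - {p} \<rightarrow>\<^sub>E {..<K})" by (simp add: finite_PiE)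
    show "\<forall>y\<in>{..<n} - {p} \<rightarrow>\<^sub>E {..<K}. finite {a. y(p := a) \<in> X}"
      using lt by (auto intro: finite_subset[of _ "{..<K}"])
  qed
  finally show ?thesis .
qed

text \<open>Fibrewise, compression replaces a set by an initial segment of the same size. The fibre of a
  neighbourhood is the union of one-dimensional neighbourhoods of several fibres. It is at
  least as large as the largest of them, whereas after compression all of them are initial segments
  and their union is equal to the largest one.\<close>

lemma compress:
  assumes "p < n" "A \<subseteq> grid n K"
  shows compress_subset: "compress n K p A \<subseteq> grid n K"
    and card_compress: "card (compress n K p A) = card A"
    and card_mixed_nbhd_compress:
      "card (mixed_nbhd n K (Suc p) m (compress n K p A)) \<le> card (mixed_nbhd n K p m A)"
proof -
  define Y where "Y = {..<n} - {p} \<rightarrow>\<^sub>E {..<K}"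
  have grid: "y(p := a) \<in> grid n K \<longleftrightarrow> a < K" if "y \<in> Y" for y a
    using that assms(1) by (auto simp: Y_def grid_def PiE_iff extensional_def)
  have lt: "a < K" if "x(p := a) \<in> A" for x a
    using that assms by (force simp: grid_def PiE_iff)
  then have fib: "{a. x(p := a) \<in> A} \<subseteq> {..<K}" for x by auto
  show sub: "compress n K p A \<subseteq> grid n K" by (auto simp: compress_def)
  show "card (compress n K p A) = card A"
    unfolding card_eq_sum_fibres[OF assms(1) sub] card_eq_sum_fibres[OF assms] Y_def[symmetric]
  proof (rule sum.cong[OF refl])
    fix y assume y: "y \<in> Y"
    have "card {a. y(p := a) \<in> A} \<le> K" using card_mono[OF _ fib] by simp
    then have "{a. y(p := a) \<in> compress n K p A} = {..<card {a. y(p := a) \<in> A}}"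
      using y by (auto simp: compress_def grid)
    then show "card {a. y(p := a) \<in> compress n K p A} = card {a. y(p := a) \<in> A}" by simp
  qed
  have nb: "mixed_nbhd n K q m X \<subseteq> grid n K" for q X by (auto simp: mixed_nbhd_def)
  show "card (mixed_nbhd n K (Suc p) m (compress n K p A)) \<le> card (mixed_nbhd n K p m A)"
    unfolding card_eq_sum_fibres[OF assms(1) nb] Y_def[symmetric]
  proof (rule sum_mono)
    fix y assume y: "y \<in> Y"
    define F' where "F' = {a. y(p := a) \<in> mixed_nbhd n K (Suc p) m (compress n K p A)}"
    define F where "F = {a. y(p := a) \<in> mixed_nbhd n K p m A}"
    have fin: "finite F'" "finite F"
      by (rule finite_subset[of _ "{..<K}"]; auto simp: F'_def F_def mixed_nbhd_def grid[OF y])+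
    have split: "(\<Sum>i<n. g i) = (\<Sum>i\<in>{..<n} - {p}. g i) + g p" for g :: "nat \<Rightarrow> nat"
      using assms(1) by (subst sum.remove[of _ p]) auto
    have "card F' \<le> card F"
    proof (cases "F' = {}")
      case False
      define a where "a = Max F'"
      have "a \<in> F'" using False fin by (simp add: a_def)
      then obtain x where x: "x \<in> compress n K p A" "a < K"
        "(\<Sum>i<n. mixed_gap K (Suc p) i ((y(p := a)) i) (x i)) \<le> m"
        by (auto simp: F'_def mixed_nbhd_def grid[OF y])
      define S where "S = {a. x(p := a) \<in> A}"
      have S: "S \<subseteq> {..<K}" "x p < card S" using x(1) fib by (auto simp: S_def compress_def)
      define R where "R = (\<Sum>i\<in>{..<n} - {p}. mixed_gap K p i (y i) (x i))"
      define e where "e = m - R"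
      have "(\<Sum>i\<in>{..<n} - {p}. mixed_gap K (Suc p) i ((y(p := a)) i) (x i)) = R"
        unfolding R_def by (intro sum.cong) (auto simp: mixed_gap_def)
      then have R: "R + chain_gap a (x p) \<le> m"
        using x(3) unfolding split by (simp add: mixed_gap_def)
      then have "a + 1 \<le> min K (card S + 2 * e)"
        using S(2) x(2) by (simp add: e_def chain_gap_def)
      also have "\<dots> \<le> card {a. a < K \<and> (\<exists>b\<in>S. circ_gap K a b \<le> e)}"
        using x(2) S by (intro card_circ_nbhd) auto
      also have "\<dots> \<le> card F"
      proof (intro card_mono fin subsetI)
        fix c assume "c \<in> {a. a < K \<and> (\<exists>b\<in>S. circ_gap K a b \<le> e)}"
        then obtain b where b: "c < K" "x(p := b) \<in> A" "circ_gap K c b \<le> e" by (auto simp: S_def)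
        have "(\<Sum>i\<in>{..<n} - {p}. mixed_gap K p i ((y(p := c)) i) ((x(p := b)) i)) = R"
          unfolding R_def by (intro sum.cong) auto
        then have "(\<Sum>i<n. mixed_gap K p i ((y(p := c)) i) ((x(p := b)) i)) \<le> m"
          unfolding split using b(3) R by (simp add: mixed_gap_def e_def)
        then show "c \<in> F" using b(1,2) unfolding F_def mixed_nbhd_def mem_Collect_eq
          by (intro conjI bexI[of _ "x(p := b)"]) (simp_all only: grid[OF y])
      qed
      finally have "a + 1 \<le> card F" .
      moreover have "F' \<subseteq> {..a}" using fin by (auto simp: a_def)
      then have "card F' \<le> a + 1" using card_mono[of "{..a}" F'] by simp
      ultimately show ?thesis by simp
    qed auto
    then show "card {a. y(p := a) \<in> mixed_nbhd n K (Suc p) m (compress n K p A)}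
        \<le> card {a. y(p := a) \<in> mixed_nbhd n K p m A}" by (simp add: F_def F'_def)
  qed
qed

lemma compress_down:
  assumes "A \<subseteq> grid n K" "x \<in> compress n K p A" "i < n" "j \<le> x i"
    and down: "i \<noteq> p \<Longrightarrow> (\<And>z l. z \<in> A \<Longrightarrow> l \<le> z i \<Longrightarrow> z(i := l) \<in> A)"
  shows "x(i := j) \<in> compress n K p A"
proof -
  have x: "x \<in> grid n K" "x p < card {a. x(p := a) \<in> A}" using assms(2) by (auto simp: compress_def)
  have "x i < K" using x(1) assms(3) by (auto simp: grid_def)
  then have g: "x(i := j) \<in> grid n K" using x(1) assms(3,4) by (intro grid_update_less) auto
  show ?thesis
  proof (cases "i = p")
    case True
    then show ?thesis using x g assms(4) by (simp add: compress_def)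
  next
    case False
    have "{a. x(p := a) \<in> A} \<subseteq> {a. (x(i := j))(p := a) \<in> A}"
    proof (intro subsetI, unfold mem_Collect_eq)
      fix a assume "x(p := a) \<in> A"
      with False assms(4) have "(x(p := a))(i := j) \<in> A" by (intro down) auto
      with False show "(x(i := j))(p := a) \<in> A" by (simp only: fun_upd_twist)
    qed
    moreover have "finite {a. (x(i := j))(p := a) \<in> A}"
    proof (rule finite_subset)
      show "{a. (x(i := j))(p := a) \<in> A} \<subseteq> (\<lambda>z. z p) ` A"
      proof
        fix a assume "a \<in> {a. (x(i := j))(p := a) \<in> A}"
        then show "a \<in> (\<lambda>z. z p) ` A" by (intro image_eqI[of _ _ "(x(i := j))(p := a)"]) simp_all
      qed
      show "finite ((\<lambda>z. z p) ` A)" using assms(1) finite_subset[OF _ finite_grid] by blast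
    qed
    ultimately have "card {a. x(p := a) \<in> A} \<le> card {a. (x(i := j))(p := a) \<in> A}"
      by (rule card_mono[rotated])
    then show ?thesis using x g False by (simp add: compress_def)
  qed
qed

lemma exists_compressed:
  assumes "A \<subseteq> grid n K" "p \<le> n"
  shows "\<exists>D \<subseteq> grid n K. card D = card A \<and>
     card (mixed_nbhd n K p m D) \<le> card (mixed_nbhd n K 0 m A) \<and>
     (\<forall>x\<in>D. \<forall>i<p. \<forall>j\<le>x i. x(i := j) \<in> D)"
  using \<open>p \<le> n\<close>
proof (induction p)
  case 0
  then show ?case using assms(1) by auto
next
  case (Suc p)
  then obtain D where D: "D \<subseteq> grid n K" "card D = card A"
    "card (mixed_nbhd n K p m D) \<le> card (mixed_nbhd n K 0 m A)"
    "\<forall>x\<in>D. \<forall>i<p. \<forall>j\<le>x i. x(i := j) \<in> D"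
    using Suc_leD by blast
  have "p < n" using Suc.prems by simp
  note c = compress[OF \<open>p < n\<close> D(1)]
  have "x(i := j) \<in> compress n K p D" if "x \<in> compress n K p D" "i < Suc p" "j \<le> x i" for x i j
    using that \<open>p < n\<close> by (intro compress_down[OF D(1)] D(4)[rule_format]) auto
  then show ?case using c(1,2) order_trans[OF c(3) D(3)] D(2)
    by (intro exI[of _ "compress n K p D"]) (auto simp del: fun_upd_apply)
qed

text \<open>After compression of all coordinates the set is closed under decreasing coordinates, and the
  problem is the one in the grid. The distance of the chain is at most half the usual one, up to
  one half for rounding in each coordinate; hence the radius \<open>2 * m - n\<close>.\<close>

lemma discrete_torus_isoperimetry:
  assumes "K > 0" "A \<subseteq> grid n K" "n \<le> 2 * m"
    and vol: "card {x \<in> grid n K. (\<Sum>i<n. x i) \<le> \<rho>} \<le> card A"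
  shows "card {x \<in> grid n K. (\<Sum>i<n. x i) \<le> \<rho> + 2 * m - n}
     \<le> card {x \<in> grid n K. \<exists>y\<in>A. (\<Sum>i<n. circ_gap K (x i) (y i)) \<le> m}"
proof -
  obtain D where D: "D \<subseteq> grid n K" "card D = card A"
    "card (mixed_nbhd n K n m D) \<le> card (mixed_nbhd n K 0 m A)"
    "\<And>x i j. x \<in> D \<Longrightarrow> i < n \<Longrightarrow> j \<le> x i \<Longrightarrow> x(i := j) \<in> D"
    using exists_compressed[OF assms(2) order_refl, of m] by blast
  have "simplex_vol K n (real \<rho> + 1) \<le> real (card D)"
    using vol D(2) by (simp add: simplex_vol_Suc_nat)
  then have "simplex_vol K n (real \<rho> + 1 + real (2 * m - n)) \<le> real (card (l1_nbhd n K (2 * m - n) D))"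
    using assms(1) D by (intro grid_downset_isoperimetry) auto
  moreover have "real \<rho> + 1 + real (2 * m - n) = real (\<rho> + 2 * m - n) + 1"
    using assms(3) by (simp add: of_nat_diff)
  ultimately have "card {x \<in> grid n K. (\<Sum>i<n. x i) \<le> \<rho> + 2 * m - n} \<le> card (l1_nbhd n K (2 * m - n) D)"
    by (simp only: simplex_vol_Suc_nat of_nat_le_iff)
  also have "\<dots> \<le> card (mixed_nbhd n K n m D)"
  proof (rule card_mono)
    show "finite (mixed_nbhd n K n m D)"
      by (rule finite_subset[OF _ finite_grid]) (auto simp: mixed_nbhd_def)
    show "l1_nbhd n K (2 * m - n) D \<subseteq> mixed_nbhd n K n m D"
    proof
      fix x assume "x \<in> l1_nbhd n K (2 * m - n) D"
      then obtain y where y: "x \<in> grid n K" "y \<in> D" "(\<Sum>i<n. nat \<bar>int (x i) - int (y i)\<bar>) \<le> 2 * m - n"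
        by (auto simp: l1_nbhd_def)
      have "2 * (\<Sum>i<n. mixed_gap K n i (x i) (y i)) = (\<Sum>i<n. 2 * mixed_gap K n i (x i) (y i))"
        by (simp add: sum_distrib_left)
      also have "\<dots> \<le> (\<Sum>i<n. nat \<bar>int (x i) - int (y i)\<bar> + 1)"
        by (intro sum_mono) (auto simp: mixed_gap_def chain_gap_def)
      also have "\<dots> = (\<Sum>i<n. nat \<bar>int (x i) - int (y i)\<bar>) + n"
        by (simp only: sum.distrib) simp
      finally show "x \<in> mixed_nbhd n K n m D" using y assms(3) by (auto simp: mixed_nbhd_def intro!: bexI[of _ y])
    qed
  qed
  also note D(3)
  finally show ?thesis by (simp add: mixed_nbhd_def mixed_gap_def)
qed

section \<open>Discretization of the circle\<close>

lemma space_circle_measure: "space circle_measure = circle"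
  by (simp add: circle_measure_def space_restrict_space)

lemma sets_circle_measure: "sets circle_measure = sets (restrict_space borel circle)"
  by (simp add: circle_measure_def)

lemma measure_circle_measure:
  assumes "E \<in> sets circle_measure"
  shows "measure circle_measure E = measure lborel {t \<in> {0..<2 * pi}. cis t \<in> E} / (2 * pi)"
proof -
  have m0: "cis \<in> measurable lborel (restrict_space borel circle)"
  proof (intro measurable_restrict_space2)
    show "cis \<in> borel_measurable lborel"
      by (auto intro!: borel_measurable_continuous_onI continuous_intros)
  qed (auto simp: circle_def)
  then have m: "cis \<in> measurable (uniform_measure lborel {0..<2 * pi}) (restrict_space borel circle)"
    by simp
  have "cis -` E \<inter> space lborel \<in> sets lborel"
    using measurable_sets[OF m0] assms by (simp add: sets_circle_measure)
  then have s: "cis -` E \<in> sets lborel" by simp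
  have "measure circle_measure E = measure (uniform_measure lborel {0..<2 * pi}) (cis -` E)"
    unfolding circle_measure_def using assms
    by (subst measure_distr[OF m]) (auto simp: sets_circle_measure)
  also have "\<dots> = measure lborel ({0..<2 * pi} \<inter> cis -` E) / measure lborel {0..<2 * pi}"
    using s by (intro measure_uniform_measure) auto
  also have "{0..<2 * pi} \<inter> cis -` E = {t \<in> {0..<2 * pi}. cis t \<in> E}" by auto
  finally show ?thesis by simp
qed

definition arc :: "nat \<Rightarrow> nat \<Rightarrow> complex set" where
  "arc K a = cis ` {2 * pi * a / K..<2 * pi * (a + 1) / K}"

lemma cis_eq_imp_eq:
  assumes "cis s = cis t" "0 \<le> s" "s < 2 * pi" "0 \<le> t" "t < 2 * pi"
  shows "s = t"
proof -
  have "sin s = sin t \<and> cos s = cos t" using assms(1) by (simp add: complex_eq_iff)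
  then obtain n :: int where n: "s = t + 2 * pi * n" by (auto simp: sin_cos_eq_iff)
  then have "\<bar>2 * pi * n\<bar> < 2 * pi" using assms by linarith
  then have "\<bar>real_of_int n\<bar> < 1" by (simp add: abs_mult)
  then have "n = 0" by linarith
  with n show ?thesis by simp
qed

lemma arc_bound:
  fixes a K :: nat
  assumes "a < K" "2 * pi * real a / real K \<le> t" "t < 2 * pi * (real a + 1) / real K"
  shows "0 \<le> t" "t < 2 * pi"
proof -
  have "0 \<le> 2 * pi * real a / real K" by simp
  then show "0 \<le> t" using assms by linarith
  have "2 * pi * (real a + 1) / real K \<le> 2 * pi * real K / real K"
    using assms(1) by (intro divide_right_mono mult_left_mono) auto
  also have "\<dots> = 2 * pi" using assms(1) by simp
  finally have "2 * pi * (real a + 1) / real K \<le> 2 * pi" .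
  then show "t < 2 * pi" using assms by linarith
qed

text \<open>A half-open interval is a countable union of compact ones, and continuous images of compact sets
  are closed.\<close>

lemma sets_arc: "arc K a \<in> sets circle_measure"
proof -
  define l u where "l = 2 * pi * a / K" and "u = 2 * pi * (a + 1) / K"
  have "{l..<u} = (\<Union>j::nat. {l..u - 1 / Suc j})"
  proof (intro equalityI subsetI)
    fix x assume x: "x \<in> {l..<u}"
    then obtain j :: nat where "1 / (real j + 1) < u - x"
      using reals_Archimedean[of "u - x"] by (auto simp: inverse_eq_divide add.commute)
    then show "x \<in> (\<Union>j::nat. {l..u - 1 / Suc j})" using x by (auto intro!: exI[of _ j] simp: add.commute)
  next
    fix x assume "x \<in> (\<Union>j::nat. {l..u - 1 / Suc j})"
    then obtain j :: nat where "l \<le> x" "x \<le> u - 1 / Suc j" by auto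
    moreover have "0 < 1 / real (Suc j)" by simp
    ultimately have "l \<le> x" "x < u" by linarith+
    then show "x \<in> {l..<u}" by simp
  qed
  then have "arc K a = (\<Union>j::nat. cis ` {l..u - 1 / Suc j})"
    by (simp add: arc_def l_def u_def image_UN)
  moreover have "cis ` {l..v} \<in> sets borel" for v
    by (intro borel_closed compact_imp_closed compact_continuous_image continuous_intros) auto
  ultimately have "arc K a \<in> sets borel" by auto
  moreover have "arc K a = circle \<inter> arc K a" by (auto simp: arc_def circle_def)
  ultimately show ?thesis by (simp add: sets_circle_measure sets_restrict_space image_iff) blast
qed

lemma measure_arc:
  assumes "a < K"
  shows "measure circle_measure (arc K a) = 1 / K"
proof -
  have "{t \<in> {0..<2 * pi}. cis t \<in> arc K a} = {2 * pi * a / K..<2 * pi * (a + 1) / K}"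
  proof (intro equalityI subsetI)
    fix t assume "t \<in> {t \<in> {0..<2 * pi}. cis t \<in> arc K a}"
    then obtain s where s: "0 \<le> t" "t < 2 * pi" "cis t = cis s"
      "2 * pi * a / K \<le> s" "s < 2 * pi * (real a + 1) / K" by (auto simp: arc_def add.commute)
    have "t = s" using s arc_bound[OF assms s(4,5)] by (intro cis_eq_imp_eq) auto
    then show "t \<in> {2 * pi * a / K..<2 * pi * (a + 1) / K}" using s by (simp add: add.commute)
  next
    fix t assume t: "t \<in> {2 * pi * a / K..<2 * pi * (a + 1) / K}"
    then show "t \<in> {t \<in> {0..<2 * pi}. cis t \<in> arc K a}"
      using arc_bound[OF assms, of t] by (auto simp: arc_def add.commute)
  qed
  moreover have "measure lborel {2 * pi * a / K..<2 * pi * (a + 1) / K} = 2 * pi / K"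
  proof -
    have "2 * pi * (real a + 1) / K - 2 * pi * a / K = 2 * pi / K"
      by (simp add: add_divide_distrib ring_distribs)
    moreover have "2 * pi * real a / K \<le> 2 * pi * (real a + 1) / K"
      by (intro divide_right_mono mult_left_mono) auto
    ultimately show ?thesis by (simp add: add.commute)
  qed
  ultimately show ?thesis by (simp add: measure_circle_measure[OF sets_arc])
qed

lemma arc_index_unique:
  fixes a b K :: nat
  assumes "K > 0" "2 * pi * a / K \<le> s" "s < 2 * pi * (real b + 1) / K"
  shows "a \<le> b"
proof -
  have "2 * pi * a / K < 2 * pi * (real b + 1) / K" using assms by linarith
  then have "real a < real b + 1" using assms(1) by (simp add: divide_less_cancel)
  then show ?thesis by linarith
qed

lemma arc_disjoint:
  assumes "a < K" "b < K" "x \<in> arc K a" "x \<in> arc K b"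
  shows "a = b"
proof -
  obtain s where s: "x = cis s" "2 * pi * a / K \<le> s" "s < 2 * pi * (real a + 1) / K"
    using assms(3) by (auto simp: arc_def add.commute)
  obtain t where t: "x = cis t" "2 * pi * b / K \<le> t" "t < 2 * pi * (real b + 1) / K"
    using assms(4) by (auto simp: arc_def add.commute)
  have "s = t" using s t arc_bound[OF assms(1) s(2,3)] arc_bound[OF assms(2) t(2,3)]
    by (intro cis_eq_imp_eq) auto
  then have "a \<le> b" "b \<le> a"
    using arc_index_unique[of K a s b] arc_index_unique[of K b s a] assms s t by auto
  then show ?thesis by simp
qed

lemma arc_cover:
  assumes "K > 0" "x \<in> circle"
  shows "\<exists>a<K. x \<in> arc K a"
proof -
  define t where "t = Arg2pi x"
  have t: "0 \<le> t" "t < 2 * pi" by (simp_all add: t_def Arg2pi_ge_0 Arg2pi_lt_2pi)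
  have x: "x = cis t" using Arg2pi_eq[of x] assms(2) by (simp add: t_def circle_def cis_conv_exp)
  define a where "a = nat \<lfloor>t * K / (2 * pi)\<rfloor>"
  have "0 \<le> t * K / (2 * pi)" using t by simp
  then have a: "real a \<le> t * K / (2 * pi)" "t * K / (2 * pi) < real a + 1"
    unfolding a_def by linarith+
  have "t * K / (2 * pi) < K" using t assms(1) by (simp add: divide_less_eq mult.commute)
  then have "a < K" using a by linarith
  moreover have "2 * pi * a / K \<le> t" "t < 2 * pi * (real a + 1) / K"
    using a assms(1) by (simp_all add: field_simps)
  ultimately show ?thesis using x by (auto simp: arc_def add.commute)
qed

text \<open>Points of two arcs are, up to multiples of the full circle, \<open>d\<close> arc lengths apart with an error
  of less than one arc length, where \<open>\<bar>d\<bar>\<close> is the distance of the arcs in the cycle.\<close>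

lemma circle_dist_arc:
  assumes "a < K" "b < K" "x \<in> arc K a" "y \<in> arc K b"
  shows "circle_dist x y \<le> (circ_gap K a b + 1) * (2 * pi / K)"
proof -
  define h where "h = 2 * pi / K"
  have K: "0 < K" "K * h = 2 * pi" using assms by (auto simp: h_def)
  obtain s where s: "x = cis s" "a * h \<le> s" "s < (real a + 1) * h"
    using assms(3) by (auto simp: arc_def h_def field_simps)
  obtain t where t: "y = cis t" "b * h \<le> t" "t < (real b + 1) * h"
    using assms(4) by (auto simp: arc_def h_def field_simps)
  obtain d where d: "\<bar>d\<bar> \<le> int (circ_gap K a b)" "int a mod int K = (int b + d) mod int K"
    using circ_gap_le_iff[OF K(1), of a b "circ_gap K a b"] by auto
  then obtain k where "int a = int b + d + k * int K"
    by (metis mod_eqE mult.commute diff_eq_eq add.commute diff_add_cancel)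
  then have "real a = real b + d + k * real K" by (metis of_int_add of_int_mult of_int_of_nat_eq)
  then have "real a * h = real b * h + d * h + k * (K * h)" by (simp add: algebra_simps)
  then have ah: "real a * h = real b * h + d * h + k * (2 * pi)" by (simp add: K)
  have "cis (- (2 * pi * k)) = 1" using cis_multiple_2pi[of "- of_int k"] by simp
  then have "cis s = cis (s - 2 * pi * k)" by (metis cis_mult mult.right_neutral diff_conv_add_uminus)
  then have "x / y = cis (s - 2 * pi * k - t)" by (simp add: s t cis_divide)
  then have "circle_dist x y \<le> \<bar>s - 2 * pi * k - t\<bar>"
    unfolding circle_dist_def using abs_Arg_cis_le by metis
  also have "\<dots> \<le> \<bar>real_of_int d\<bar> * h + h"
  proof -
    have "0 \<le> h" by (simp add: h_def)
    then have "\<bar>d * h\<bar> = \<bar>real_of_int d\<bar> * h" by (simp add: abs_mult)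
    moreover have "\<bar>s - 2 * pi * k - t - d * h\<bar> \<le> h"
      using s t ah by (simp add: algebra_simps abs_le_iff)
    ultimately show ?thesis by linarith
  qed
  also have "\<dots> \<le> (circ_gap K a b + 1) * h"
  proof -
    have "\<bar>real_of_int d\<bar> \<le> circ_gap K a b" using d(1) by linarith
    then have "\<bar>real_of_int d\<bar> * h \<le> circ_gap K a b * h" by (intro mult_right_mono) (auto simp: h_def)
    then show ?thesis by (simp add: algebra_simps)
  qed
  finally show ?thesis by (simp add: h_def)
qed

lemma circle_dist_le_pi: "circle_dist x y \<le> pi"
  unfolding circle_dist_def using Arg_bounded[of "x / y"] by linarith

lemma circle_dist_nonneg: "0 \<le> circle_dist x y"
  by (simp add: circle_dist_def)

text \<open>This form of the distance is continuous, which gives measurability.\<close>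

lemma circle_dist_eq_arccos:
  assumes "x \<in> circle" "y \<in> circle"
  shows "circle_dist x y = arccos (Re (x / y))"
proof -
  have "x / y = cis (Arg (x / y))"
    using rcis_cmod_Arg[of "x / y"] assms by (simp add: circle_def norm_divide rcis_def)
  then have "Re (x / y) = cos (Arg (x / y))" by (metis cis.simps(1))
  also have "\<dots> = cos \<bar>Arg (x / y)\<bar>" by simp
  finally have "arccos (Re (x / y)) = arccos (cos \<bar>Arg (x / y)\<bar>)" by simp
  also have "\<dots> = \<bar>Arg (x / y)\<bar>" using Arg_bounded[of "x / y"] by (intro arccos_cos) auto
  finally show ?thesis by (simp add: circle_dist_def)
qed

lemma measurable_circle_dist:
  assumes "c \<in> circle"
  shows "circle_dist c \<in> borel_measurable circle_measure"
proof -
  have "continuous_on circle (\<lambda>x. arccos (Re (c / x)))"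
  proof (intro continuous_on_arccos continuous_intros)
    have "\<bar>Re (c / x)\<bar> \<le> 1" if "x \<in> circle" for x
      using abs_Re_le_cmod[of "c / x"] that assms by (simp add: circle_def norm_divide)
    then show "\<forall>x\<in>circle. - 1 \<le> Re (c / x) \<and> Re (c / x) \<le> 1" by (auto simp: abs_le_iff)
    show "\<forall>x\<in>circle. x \<noteq> 0" by (auto simp: circle_def)
  qed
  then have "continuous_on circle (circle_dist c)"
    by (rule continuous_on_eq) (simp add: circle_dist_eq_arccos assms)
  then have "circle_dist c \<in> borel_measurable (restrict_space borel circle)"
    by (rule borel_measurable_continuous_on_restrict)
  then show ?thesis by (subst measurable_cong_sets[OF sets_circle_measure refl])
qed

text \<open>The distance from a fixed point \<open>c\<close> is uniformly distributed on \<open>{0..pi}\<close>. In the parameter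
  interval the points of distance less than \<open>s\<close> form an interval of length \<open>2 * s\<close> around the
  angle of \<open>c\<close>, which may be cut into two at either end.\<close>

lemma measure_circle_dist_ge:
  assumes "c \<in> circle" "0 \<le> s" "s \<le> pi"
  shows "measure circle_measure {x \<in> circle. s \<le> circle_dist c x} = 1 - s / pi"
proof -
  interpret prob_space circle_measure by (rule prob_space_circle_measure)
  have sets: "{x \<in> circle. circle_dist c x < s} \<in> sets circle_measure"
    using measurable_sets[OF measurable_circle_dist[OF assms(1)], of "{..<s}"]
    by (simp add: vimage_def space_circle_measure Int_def conj_commute)
  define \<theta> where "\<theta> = Arg2pi c"
  have \<theta>: "0 \<le> \<theta>" "\<theta> < 2 * pi" by (simp_all add: \<theta>_def Arg2pi_ge_0 Arg2pi_lt_2pi)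
  have c: "c = cis \<theta>" using Arg2pi_eq[of c] assms(1) by (simp add: \<theta>_def circle_def cis_conv_exp)
  have dist: "circle_dist c (cis t) = (if \<bar>\<theta> - t\<bar> \<le> pi then \<bar>\<theta> - t\<bar> else 2 * pi - \<bar>\<theta> - t\<bar>)"
    if t: "0 \<le> t" "t < 2 * pi" for t
  proof -
    have cos: "circle_dist c (cis t) = arccos (cos (\<theta> - t))"
      by (subst circle_dist_eq_arccos[OF assms(1)]) (auto simp: circle_def c cis_divide)
    show ?thesis
    proof (cases "\<bar>\<theta> - t\<bar> \<le> pi")
      case True
      have "arccos (cos \<bar>\<theta> - t\<bar>) = \<bar>\<theta> - t\<bar>" using True by (intro arccos_cos) auto
      then show ?thesis using True cos by simp
    next
      case False
      have "cos (2 * pi - \<bar>\<theta> - t\<bar>) = cos \<bar>\<theta> - t\<bar>" by (simp add: cos_diff)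
      moreover have "arccos (cos (2 * pi - \<bar>\<theta> - t\<bar>)) = 2 * pi - \<bar>\<theta> - t\<bar>"
        using False \<theta> t by (intro arccos_cos) auto
      ultimately show ?thesis using False cos by simp
    qed
  qed
  define I where "I = {t \<in> {0..<2 * pi}. cis t \<in> {x \<in> circle. circle_dist c x < s}}"
  have I: "I = {t \<in> {0..<2 * pi}. (if \<bar>\<theta> - t\<bar> \<le> pi then \<bar>\<theta> - t\<bar> else 2 * pi - \<bar>\<theta> - t\<bar>) < s}"
    unfolding I_def using dist by (auto simp: circle_def)
  have two: "measure lborel ({u..<v} \<union> {u'<..<v'}) = (v - u) + (v' - u')"
    if "u \<le> v" "v \<le> u'" "u' \<le> v'" for u v u' v' :: real
    using that by (subst measure_Union) auto
  consider "s \<le> \<theta>" "\<theta> + s \<le> 2 * pi" | "\<theta> < s" | "2 * pi < \<theta> + s" by linarith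
  then have "measure lborel I = 2 * s"
  proof cases
    case 1
    have "I = {\<theta> - s<..<\<theta> + s}" using 1 \<theta> assms unfolding I by (auto split: if_splits)
    then show ?thesis using assms by simp
  next
    case 2
    have "I = {0..<\<theta> + s} \<union> {\<theta> - s + 2 * pi<..<2 * pi}"
      using 2 \<theta> assms unfolding I by (auto split: if_splits)
    then show ?thesis using 2 \<theta> assms by (simp add: two)
  next
    case 3
    have "I = {0..<\<theta> + s - 2 * pi} \<union> {\<theta> - s<..<2 * pi}"
      using 3 \<theta> assms unfolding I by (auto split: if_splits)
    then show ?thesis using 3 \<theta> assms by (simp add: two)
  qed
  then have "prob {x \<in> circle. circle_dist c x < s} = s / pi"
    using measure_circle_measure[OF sets] by (simp add: I_def)
  moreover have "{x \<in> circle. s \<le> circle_dist c x} = space circle_measure - {x \<in> circle. circle_dist c x < s}"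
    by (auto simp: space_circle_measure)
  ultimately show ?thesis using prob_compl[OF sets] by simp
qed

text \<open>The shells cut the circle by distance from \<open>c\<close> into \<open>K\<close> pieces of equal measure. The last one
  is closed, so that it contains the antipode of \<open>c\<close>. With respect to products of shells, balls
  around \<open>c\<close> look like simplices in the grid; this describes the measure of balls without
  computing it.\<close>

definition shell :: "nat \<Rightarrow> complex \<Rightarrow> nat \<Rightarrow> complex set" where
  "shell K c z = {x \<in> circle. z * (pi / K) \<le> circle_dist c x \<and>
     (Suc z < K \<longrightarrow> circle_dist c x < Suc z * (pi / K))}"

lemma measure_shell:
  assumes "c \<in> circle" "z < K"
  shows "shell K c z \<in> sets circle_measure" "measure circle_measure (shell K c z) = 1 / K"
proof -
  interpret prob_space circle_measure by (rule prob_space_circle_measure)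
  define G where "G s = {x \<in> circle. s \<le> circle_dist c x}" for s
  have sets: "G s \<in> sets circle_measure" for s
    using measurable_sets[OF measurable_circle_dist[OF assms(1)], of "{s..}"]
    by (simp add: vimage_def space_circle_measure Int_def conj_commute G_def)
  have mG: "prob (G (y * (pi / K))) = 1 - y / K" if "y \<le> K" for y :: nat
    using measure_circle_dist_ge[OF assms(1), of "y * (pi / K)"] that assms(2)
    by (simp add: G_def field_simps)
  have "shell K c z \<in> sets circle_measure \<and> measure circle_measure (shell K c z) = 1 / K"
  proof (cases "Suc z < K")
    case True
    then have eq: "shell K c z = G (z * (pi / K)) - G (Suc z * (pi / K))"
      by (auto simp: shell_def G_def)
    have "z * (pi / K) \<le> Suc z * (pi / K)" by (intro mult_right_mono) auto
    then have "G (Suc z * (pi / K)) \<subseteq> G (z * (pi / K))" by (auto simp: G_def)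
    then have "prob (shell K c z) = prob (G (z * (pi / K))) - prob (G (Suc z * (pi / K)))"
      unfolding eq by (intro finite_measure_Diff sets)
    also have "\<dots> = (1 - z / K) - (1 - Suc z / K)"
      using True by (simp only: mG)
    also have "\<dots> = 1 / K" by (simp add: diff_divide_distrib add_divide_distrib)
    finally show ?thesis using sets by (auto simp: eq)
  next
    case False
    then have K: "K = Suc z" using assms(2) by simp
    have eq: "shell K c z = G (z * (pi / K))" using False by (auto simp: shell_def G_def)
    have "1 - real z / K = 1 / K" by (simp add: K field_simps)
    then show ?thesis using sets mG[of z] assms(2) by (simp add: eq)
  qed
  then show "shell K c z \<in> sets circle_measure" "measure circle_measure (shell K c z) = 1 / K" by auto
qed

lemma shell_disjoint:
  assumes "y < K" "z < K" "x \<in> shell K c y" "x \<in> shell K c z"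
  shows "y = z"
proof (rule ccontr)
  have *: "\<not> y < z" if "z < K" "x \<in> shell K c y" "x \<in> shell K c z" for y z
  proof
    assume "y < z"
    then have "circle_dist c x < Suc y * (pi / K)" "z * (pi / K) \<le> circle_dist c x"
      using that by (auto simp: shell_def)
    moreover have "Suc y * (pi / K) \<le> z * (pi / K)"
      using \<open>y < z\<close> by (intro mult_right_mono) auto
    ultimately show False by linarith
  qed
  assume "y \<noteq> z"
  then show False using *[of z y] *[of y z] assms by linarith
qed

lemma shell_cover:
  assumes "K > 0" "x \<in> circle"
  shows "\<exists>z<K. x \<in> shell K c z"
proof -
  define u where "u = circle_dist c x * K / pi"
  have "0 \<le> u" by (simp add: u_def circle_dist_nonneg)
  then have u: "nat \<lfloor>u\<rfloor> \<le> u" "u < nat \<lfloor>u\<rfloor> + 1" by linarith+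
  define z where "z = min (K - 1) (nat \<lfloor>u\<rfloor>)"
  have "real z \<le> u" using u(1) by (simp add: z_def min_def)
  moreover have "u < real (Suc z)" if "Suc z < K" using u(2) that by (auto simp: z_def min_def split: if_splits)
  ultimately have "x \<in> shell K c z" using assms by (auto simp: shell_def u_def field_simps)
  moreover have "z < K" using assms by (simp add: z_def)
  ultimately show ?thesis by blast
qed

lemma measure_cells:
  fixes E :: "nat \<Rightarrow> nat \<Rightarrow> complex set"
  assumes E: "\<And>i a. i < n \<Longrightarrow> a < K \<Longrightarrow> E i a \<in> sets circle_measure"
    "\<And>i a. i < n \<Longrightarrow> a < K \<Longrightarrow> measure circle_measure (E i a) = 1 / K"
    and disj: "\<And>i a b x. i < n \<Longrightarrow> a < K \<Longrightarrow> b < K \<Longrightarrow> x \<in> E i a \<Longrightarrow> x \<in> E i b \<Longrightarrow> a = b"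
    and X: "X \<subseteq> grid n K"
  defines "U \<equiv> \<Union>x\<in>X. PiE {..<n} (\<lambda>i. E i (x i))"
  shows "U \<in> sets (torus_measure n)" "measure (torus_measure n) U = card X / real K ^ n"
proof -
  interpret T: prob_space "torus_measure n" by (rule prob_space_torus_measure)
  interpret product_prob_space "\<lambda>_ :: nat. circle_measure" "{..<n}"
    by (intro product_prob_spaceI prob_space_circle_measure)
  interpret P: finite_product_prob_space "\<lambda>_ :: nat. circle_measure" "{..<n}"
    by standard simp
  have fin: "finite X" using X finite_subset finite_grid by blast
  have lt: "x i < K" if "x \<in> X" "i < n" for x i using that X by (auto simp: grid_def)
  have cell: "PiE {..<n} (\<lambda>i. E i (x i)) \<in> sets (torus_measure n)" if "x \<in> X" for x
    unfolding torus_measure_def using that lt E by (intro sets_PiM_I_finite) auto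
  have m: "measure (torus_measure n) (PiE {..<n} (\<lambda>i. E i (x i))) = 1 / real K ^ n" if "x \<in> X" for x
    unfolding torus_measure_def using that lt E
    by (subst P.prob_times) (auto simp: power_one_over)
  show "U \<in> sets (torus_measure n)" unfolding U_def using fin cell by (intro sets.finite_UN) auto
  have "disjoint_family_on (\<lambda>x. PiE {..<n} (\<lambda>i. E i (x i))) X"
    unfolding disjoint_family_on_def
  proof (intro ballI impI)
    fix x y assume xy: "x \<in> X" "y \<in> X" "x \<noteq> y"
    moreover have "x \<in> {..<n} \<rightarrow>\<^sub>E {..<K}" "y \<in> {..<n} \<rightarrow>\<^sub>E {..<K}"
      using X xy by (auto simp: grid_def)
    ultimately obtain i where i: "i < n" "x i \<noteq> y i" by (metis PiE_ext lessThan_iff)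
    have False if "f \<in> PiE {..<n} (\<lambda>i. E i (x i))" "f \<in> PiE {..<n} (\<lambda>i. E i (y i))" for f
    proof -
      have "f i \<in> E i (x i)" "f i \<in> E i (y i)" using that i by (auto simp: PiE_iff)
      then show False using disj[of i "x i" "y i" "f i"] lt i xy by auto
    qed
    then show "PiE {..<n} (\<lambda>i. E i (x i)) \<inter> PiE {..<n} (\<lambda>i. E i (y i)) = {}" by blast
  qed
  then have "measure (torus_measure n) U = (\<Sum>x\<in>X. measure (torus_measure n) (PiE {..<n} (\<lambda>i. E i (x i))))"
    unfolding U_def using fin cell by (intro T.finite_measure_finite_Union) auto
  also have "\<dots> = card X / real K ^ n" using m by simp
  finally show "measure (torus_measure n) U = card X / real K ^ n" .
qed

lemma torus_dist_nonneg: "0 \<le> torus_dist n x y"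
  by (simp add: torus_dist_def sum_nonneg circle_dist_nonneg)

lemma torus_dist_commute: "torus_dist n x y = torus_dist n y x"
  by (simp add: torus_dist_def circle_dist_commute)

lemma torus_dist_triangle:
  "x \<in> torus n \<Longrightarrow> y \<in> torus n \<Longrightarrow> z \<in> torus n \<Longrightarrow> torus_dist n x z \<le> torus_dist n x y + torus_dist n y z"
  using Metric_space.triangle[OF Metric_space_torus] .

lemma torus_nbhd_iff:
  assumes "A \<noteq> {}"
  shows "x \<in> torus_nbhd n r A \<longleftrightarrow> x \<in> torus n \<and> (\<exists>y\<in>A. torus_dist n x y < r)"
proof -
  have "bdd_below ((\<lambda>y. torus_dist n x y) ` A)"
    by (rule bdd_belowI2[of _ 0]) (rule torus_dist_nonneg)
  then show ?thesis using assms by (simp add: torus_nbhd_def cINF_less_iff)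
qed

section \<open>Discretization of the torus\<close>

definition cell :: "nat \<Rightarrow> nat \<Rightarrow> (nat \<Rightarrow> nat) \<Rightarrow> (nat \<Rightarrow> complex) set" where
  "cell n K x = PiE {..<n} (\<lambda>i. arc K (x i))"

lemma cell_subset_torus: "cell n K x \<subseteq> torus n"
proof -
  have "arc K a \<subseteq> circle" for a by (auto simp: arc_def circle_def)
  then show ?thesis unfolding cell_def torus_def by (intro PiE_mono) auto
qed

lemma cell_cover:
  assumes "K > 0" "u \<in> torus n"
  shows "\<exists>x\<in>grid n K. u \<in> cell n K x"
proof -
  have "\<forall>i\<in>{..<n}. \<exists>a<K. u i \<in> arc K a"
    using assms by (auto simp: torus_def intro!: arc_cover)
  then obtain g where g: "\<And>i. i < n \<Longrightarrow> g i < K \<and> u i \<in> arc K (g i)" by (metis lessThan_iff)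
  have "restrict g {..<n} \<in> grid n K" using g by (auto simp: grid_def)
  moreover have "u \<in> cell n K (restrict g {..<n})"
    using g assms(2) by (auto simp: cell_def torus_def PiE_iff)
  ultimately show ?thesis by blast
qed

lemma torus_dist_cell:
  assumes "x \<in> grid n K" "y \<in> grid n K" "u \<in> cell n K x" "v \<in> cell n K y"
    and "(\<Sum>i<n. circ_gap K (x i) (y i)) \<le> m"
  shows "torus_dist n u v \<le> real (m + n) * (2 * pi / K)"
proof -
  have "torus_dist n u v \<le> (\<Sum>i<n. (circ_gap K (x i) (y i) + 1) * (2 * pi / K))"
    unfolding torus_dist_def
  proof (rule sum_mono)
    fix i assume "i \<in> {..<n}"
    then show "circle_dist (u i) (v i) \<le> (circ_gap K (x i) (y i) + 1) * (2 * pi / K)"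
      using assms by (intro circle_dist_arc) (auto simp: grid_def cell_def)
  qed
  also have "\<dots> = real ((\<Sum>i<n. circ_gap K (x i) (y i)) + n) * (2 * pi / K)"
    by (simp only: sum_distrib_right[symmetric] of_nat_sum[symmetric] of_nat_add[symmetric] sum.distrib) simp
  also have "\<dots> \<le> real (m + n) * (2 * pi / K)"
    using assms(5) by (intro mult_right_mono) (auto simp del: of_nat_sum)
  finally show ?thesis .
qed

lemma measure_union_cells:
  assumes "X \<subseteq> grid n K"
  shows "(\<Union>x\<in>X. cell n K x) \<in> sets (torus_measure n)"
    "measure (torus_measure n) (\<Union>x\<in>X. cell n K x) = card X / real K ^ n"
  unfolding cell_def
  using assms by (intro measure_cells; simp add: sets_arc measure_arc arc_disjoint)+

lemma measure_union_shells:
  assumes "X \<subseteq> grid n K" "\<And>i. i < n \<Longrightarrow> c i \<in> circle"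
  shows "(\<Union>x\<in>X. PiE {..<n} (\<lambda>i. shell K (c i) (x i))) \<in> sets (torus_measure n)"
    "measure (torus_measure n) (\<Union>x\<in>X. PiE {..<n} (\<lambda>i. shell K (c i) (x i))) = card X / real K ^ n"
proof -
  have E: "shell K (c i) a \<in> sets circle_measure" "measure circle_measure (shell K (c i) a) = 1 / K"
    if "i < n" "a < K" for i a using measure_shell[OF assms(2)] that by auto
  have disj: "a = b" if "i < n" "a < K" "b < K" "x \<in> shell K (c i) a" "x \<in> shell K (c i) b" for i a b x
    using shell_disjoint that by blast
  show "(\<Union>x\<in>X. PiE {..<n} (\<lambda>i. shell K (c i) (x i))) \<in> sets (torus_measure n)"
    "measure (torus_measure n) (\<Union>x\<in>X. PiE {..<n} (\<lambda>i. shell K (c i) (x i))) = card X / real K ^ n"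
    by (rule measure_cells[where E = "\<lambda>i. shell K (c i)"]; fact E disj assms(1))+
qed

text \<open>A neighbourhood is the union of the cells that it contains, over all mesh sizes.\<close>

lemma sets_torus_nbhd:
  assumes "A \<subseteq> torus n" "A \<noteq> {}"
  shows "torus_nbhd n r A \<in> sets (torus_measure n)"
proof -
  define X where "X K = {x \<in> grid n K. cell n K x \<subseteq> torus_nbhd n r A}" for K
  have "torus_nbhd n r A = (\<Union>K. \<Union>x\<in>X (Suc K). cell n (Suc K) x)"
  proof (intro equalityI subsetI)
    fix u assume u: "u \<in> torus_nbhd n r A"
    then obtain y where y: "u \<in> torus n" "y \<in> A" "torus_dist n u y < r"
      using assms by (auto simp: torus_nbhd_iff)
    define \<delta> where "\<delta> = r - torus_dist n u y"
    obtain K :: nat where "real n * (2 * pi) / \<delta> < real K" using reals_Archimedean2 by blast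
    then have K: "real n * (2 * pi / Suc K) < \<delta>" using y(3) by (simp add: \<delta>_def field_simps)
    obtain x where x: "x \<in> grid n (Suc K)" "u \<in> cell n (Suc K) x"
      using cell_cover[OF _ y(1), of "Suc K"] by auto
    have "cell n (Suc K) x \<subseteq> torus_nbhd n r A"
    proof
      fix v assume v: "v \<in> cell n (Suc K) x"
      have "torus_dist n v u \<le> real (0 + n) * (2 * pi / Suc K)"
        by (rule torus_dist_cell[OF x(1,1) v x(2)]) (simp add: circ_gap_def)
      moreover have "v \<in> torus n" using v cell_subset_torus by blast
      moreover have "torus_dist n v y \<le> torus_dist n v u + torus_dist n u y"
        using y \<open>v \<in> torus n\<close> assms by (intro torus_dist_triangle) auto
      ultimately show "v \<in> torus_nbhd n r A"
        using K y(2) assms(2) by (auto simp: torus_nbhd_iff \<delta>_def intro!: bexI[of _ y])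
    qed
    with x show "u \<in> (\<Union>K. \<Union>x\<in>X (Suc K). cell n (Suc K) x)" by (auto simp: X_def)
  qed (auto simp: X_def)
  moreover have "(\<Union>x\<in>X K. cell n K x) \<in> sets (torus_measure n)" for K
    by (rule measure_union_cells) (auto simp: X_def)
  ultimately show ?thesis by auto
qed

definition open_ball :: "nat \<Rightarrow> (nat \<Rightarrow> complex) \<Rightarrow> real \<Rightarrow> (nat \<Rightarrow> complex) set" where
  "open_ball n c s = {x \<in> torus n. torus_dist n c x < s}"

lemma sets_open_ball:
  assumes "c \<in> torus n"
  shows "open_ball n c s \<in> sets (torus_measure n)"
proof -
  have "(\<lambda>x. torus_dist n c x) \<in> borel_measurable (torus_measure n)"
    unfolding torus_dist_def torus_measure_def
  proof (rule borel_measurable_sum)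
    fix i assume i: "i \<in> {..<n}"
    then have "circle_dist (c i) \<in> borel_measurable circle_measure"
      using assms by (intro measurable_circle_dist) (auto simp: torus_def)
    then show "(\<lambda>x. circle_dist (c i) (x i)) \<in> borel_measurable (Pi\<^sub>M {..<n} (\<lambda>_. circle_measure))"
      using measurable_component_singleton[OF i] by (rule measurable_compose[rotated])
  qed
  from measurable_sets[OF this, of "{..<s}"] show ?thesis
    by (simp add: open_ball_def space_torus_measure vimage_def Int_def conj_commute)
qed

lemma card_simplex_le_measure_open_ball:
  assumes "c \<in> torus n" "K > 0" "real (\<rho> + n) * (pi / K) < s"
  shows "card {x \<in> grid n K. (\<Sum>i<n. x i) \<le> \<rho>} / real K ^ n \<le> measure (torus_measure n) (open_ball n c s)"
proof -
  interpret prob_space "torus_measure n" by (rule prob_space_torus_measure)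
  define X where "X = {x \<in> grid n K. (\<Sum>i<n. x i) \<le> \<rho>}"
  define U where "U = (\<Union>x\<in>X. PiE {..<n} (\<lambda>i. shell K (c i) (x i)))"
  have c: "c i \<in> circle" if "i < n" for i using assms(1) that by (auto simp: torus_def)
  have U: "U \<in> events" "prob U = card X / real K ^ n"
    unfolding U_def by (rule measure_union_shells; simp add: X_def c)+
  have "U \<subseteq> open_ball n c s"
  proof
    fix u assume "u \<in> U"
    then obtain x where x: "x \<in> X" "u \<in> PiE {..<n} (\<lambda>i. shell K (c i) (x i))" by (auto simp: U_def)
    have "u \<in> torus n" using x(2) by (auto simp: torus_def shell_def PiE_iff)
    have "torus_dist n c u \<le> (\<Sum>i<n. (real (x i) + 1) * (pi / K))"
      unfolding torus_dist_def
    proof (rule sum_mono)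
      fix i assume i: "i \<in> {..<n}"
      then have u: "u i \<in> shell K (c i) (x i)" "x i < K" using x by (auto simp: X_def grid_def)
      show "circle_dist (c i) (u i) \<le> (real (x i) + 1) * (pi / K)"
      proof (cases "Suc (x i) < K")
        case True
        then show ?thesis using u by (simp add: shell_def add.commute)
      next
        case False
        then have "real K = real (x i) + 1" using u by simp
        then have "(real (x i) + 1) * (pi / K) = pi" using assms(2) by simp
        then show ?thesis using circle_dist_le_pi by simp
      qed
    qed
    also have "\<dots> = real ((\<Sum>i<n. x i) + n) * (pi / K)"
      by (simp only: sum_distrib_right[symmetric] sum.distrib of_nat_add of_nat_sum) simp
    also have "\<dots> \<le> real (\<rho> + n) * (pi / K)"
      using x(1) by (intro mult_right_mono) (auto simp: X_def simp del: of_nat_sum)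
    finally show "u \<in> open_ball n c s" using assms(3) \<open>u \<in> torus n\<close> by (simp add: open_ball_def)
  qed
  then have "prob U \<le> prob (open_ball n c s)"
    by (rule finite_measure_mono) (rule sets_open_ball[OF assms(1)])
  then show ?thesis by (simp add: U X_def)
qed

lemma measure_open_ball_le_card_simplex:
  assumes "c \<in> torus n" "K > 0" "s \<le> real (\<rho> + 1) * (pi / K)"
  shows "measure (torus_measure n) (open_ball n c s) \<le> card {x \<in> grid n K. (\<Sum>i<n. x i) \<le> \<rho>} / real K ^ n"
proof -
  interpret prob_space "torus_measure n" by (rule prob_space_torus_measure)
  define X where "X = {x \<in> grid n K. (\<Sum>i<n. x i) \<le> \<rho>}"
  define U where "U = (\<Union>x\<in>X. PiE {..<n} (\<lambda>i. shell K (c i) (x i)))"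
  have c: "c i \<in> circle" if "i < n" for i using assms(1) that by (auto simp: torus_def)
  have U: "U \<in> events" "prob U = card X / real K ^ n"
    unfolding U_def by (rule measure_union_shells; simp add: X_def c)+
  have "open_ball n c s \<subseteq> U"
  proof
    fix u assume "u \<in> open_ball n c s"
    then have u: "u \<in> torus n" "torus_dist n c u < s" by (auto simp: open_ball_def)
    have "\<forall>i\<in>{..<n}. \<exists>z<K. u i \<in> shell K (c i) z"
      using assms(2) u(1) by (auto simp: torus_def intro!: shell_cover)
    then obtain g where g: "\<And>i. i < n \<Longrightarrow> g i < K \<and> u i \<in> shell K (c i) (g i)" by (metis lessThan_iff)
    define x where "x = restrict g {..<n}"
    have x: "x \<in> grid n K" "u \<in> PiE {..<n} (\<lambda>i. shell K (c i) (x i))"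
      using g u(1) by (auto simp: x_def grid_def torus_def PiE_iff)
    have "real (\<Sum>i<n. x i) * (pi / K) = (\<Sum>i<n. x i * (pi / K))"
      by (simp only: of_nat_sum sum_distrib_right)
    also have "\<dots> \<le> torus_dist n c u"
      unfolding torus_dist_def by (intro sum_mono) (use g in \<open>auto simp: x_def shell_def\<close>)
    finally have "real (\<Sum>i<n. x i) * (pi / K) < real (\<rho> + 1) * (pi / K)"
      using u(2) assms(3) by linarith
    then have "real (\<Sum>i<n. x i) < real (\<rho> + 1)"
      using assms(2) by (subst (asm) mult_less_cancel_right_pos) auto
    then have "(\<Sum>i<n. x i) \<le> \<rho>" by linarith
    then show "u \<in> U" using x by (auto simp: U_def X_def)
  qed
  then have "prob (open_ball n c s) \<le> prob U"
    by (rule finite_measure_mono) (rule U(1))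
  then show ?thesis by (simp add: U X_def)
qed

section \<open>The isoperimetric inequality on the torus\<close>

text \<open>Replace \<open>\<Omega>\<close> by the set \<open>A\<close> of cells that meet it. The comparison in the discrete torus loses only
  boundedly many steps of the mesh: \<open>n\<close> in passing from the ball to a simplex of shells,
  \<open>2 * n\<close> because points of cells at discrete distance \<open>m\<close> may be \<open>m + n\<close> arc lengths apart, \<open>n\<close> for
  the discrete inequality itself, and the rounding of \<open>R\<close> and \<open>r\<close>.\<close>

lemma torus_isoperimetry_at_scale:
  fixes K :: nat
  assumes \<Omega>: "\<Omega> \<subseteq> torus n" "\<Omega> \<noteq> {}" and c: "c \<in> torus n" and "K > 0"
    and vol: "measure (torus_measure n) (open_ball n c R) \<le> measure (torus_measure n) \<Omega>"
    and R: "real (n + 1) * (pi / K) \<le> R" and r: "real (2 * n + 1) * (2 * pi / K) \<le> r"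
  shows "measure (torus_measure n) (open_ball n c (R + r - real (4 * n + 2) * (pi / K)))
    \<le> measure (torus_measure n) (torus_nbhd n r \<Omega>)"
proof -
  interpret prob_space "torus_measure n" by (rule prob_space_torus_measure)
  define h where "h = pi / K"
  have h: "0 < h" using \<open>K > 0\<close> by (simp add: h_def)
  define A where "A = {x \<in> grid n K. cell n K x \<inter> \<Omega> \<noteq> {}}"
  \<comment> \<open>The largest integers with \<open>(\<rho> + n) * h < R\<close> and \<open>(m + n) * (2 * h) < r\<close>: arcs have length
    \<open>2 * h\<close>, whereas shells have width \<open>h\<close>.\<close>
  define \<rho> where "\<rho> = nat \<lceil>R / h\<rceil> - 1 - n"
  define m where "m = nat \<lceil>r / (2 * h)\<rceil> - n - 1"
  have "real (n + 1) \<le> R / h" using R h by (simp add: h_def[symmetric] field_simps)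
  then have "n + 1 \<le> nat \<lceil>R / h\<rceil>" and "R / h \<le> nat \<lceil>R / h\<rceil>" "nat \<lceil>R / h\<rceil> < R / h + 1"
    by linarith+
  then have \<rho>: "R / h \<le> real (\<rho> + n + 1)" "real (\<rho> + n) < R / h"
    unfolding \<rho>_def by linarith+
  have "real (2 * n + 1) * (2 * h) \<le> r" using r by (simp add: h_def)
  then have "real (2 * n + 1) \<le> r / (2 * h)" using h by (simp add: pos_le_divide_eq)
  then have "2 * n + 1 \<le> nat \<lceil>r / (2 * h)\<rceil>" and "r / (2 * h) \<le> nat \<lceil>r / (2 * h)\<rceil>"
    "nat \<lceil>r / (2 * h)\<rceil> < r / (2 * h) + 1" by linarith+
  then have m: "r / (2 * h) \<le> real (m + n + 1)" "real (m + n) < r / (2 * h)" "n \<le> m"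
    unfolding m_def by linarith+
  have A: "A \<subseteq> grid n K" by (auto simp: A_def)
  have "card {x \<in> grid n K. (\<Sum>i<n. x i) \<le> \<rho>} / real K ^ n \<le> prob (open_ball n c R)"
    using \<rho>(2) h by (intro card_simplex_le_measure_open_ball[OF c \<open>K > 0\<close>])
      (simp add: h_def[symmetric] field_simps)
  also note vol
  also have "prob \<Omega> \<le> prob (\<Union>x\<in>A. cell n K x)"
  proof (rule finite_measure_mono)
    show "\<Omega> \<subseteq> (\<Union>x\<in>A. cell n K x)"
      using cell_cover[OF \<open>K > 0\<close>] \<Omega>(1) by (fastforce simp: A_def)
  qed (rule measure_union_cells[OF A])
  also have "\<dots> = card A / real K ^ n" by (rule measure_union_cells[OF A])
  finally have "card {x \<in> grid n K. (\<Sum>i<n. x i) \<le> \<rho>} \<le> card A"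
    using \<open>K > 0\<close> by (simp add: divide_le_cancel)
  then have iso: "card {x \<in> grid n K. (\<Sum>i<n. x i) \<le> \<rho> + 2 * m - n}
     \<le> card {x \<in> grid n K. \<exists>y\<in>A. (\<Sum>i<n. circ_gap K (x i) (y i)) \<le> m}"
    using m(3) by (intro discrete_torus_isoperimetry[OF \<open>K > 0\<close> A]) auto
  define N where "N = {x \<in> grid n K. \<exists>y\<in>A. (\<Sum>i<n. circ_gap K (x i) (y i)) \<le> m}"
  have N: "N \<subseteq> grid n K" by (auto simp: N_def)
  have "prob (open_ball n c (R + r - real (4 * n + 2) * (pi / K)))
      \<le> card {x \<in> grid n K. (\<Sum>i<n. x i) \<le> \<rho> + 2 * m - n} / real K ^ n"
  proof (rule measure_open_ball_le_card_simplex[OF c \<open>K > 0\<close>])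
    have "R \<le> real (\<rho> + n + 1) * h" "r \<le> real (m + n + 1) * (2 * h)"
      using \<rho>(1) m(1) h by (simp_all add: divide_le_eq)
    then have "R + r - real (4 * n + 2) * h \<le> (real \<rho> + 2 * real m - real n + 1) * h"
      by (simp add: algebra_simps)
    also have "real \<rho> + 2 * real m - real n + 1 = real (\<rho> + 2 * m - n + 1)"
      using m(3) by (simp add: of_nat_diff)
    finally show "R + r - real (4 * n + 2) * (pi / K) \<le> real (\<rho> + 2 * m - n + 1) * (pi / K)"
      by (simp add: h_def)
  qed
  also have "\<dots> \<le> card N / real K ^ n" using iso by (simp add: N_def divide_right_mono)
  also have "\<dots> = prob (\<Union>x\<in>N. cell n K x)" by (rule measure_union_cells(2)[OF N, symmetric])
  also have "\<dots> \<le> prob (torus_nbhd n r \<Omega>)"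
  proof (rule finite_measure_mono[OF _ sets_torus_nbhd[OF \<Omega>]], rule subsetI)
    fix u assume "u \<in> (\<Union>x\<in>N. cell n K x)"
    then obtain x y where x: "x \<in> grid n K" "u \<in> cell n K x" "y \<in> A"
      "(\<Sum>i<n. circ_gap K (x i) (y i)) \<le> m" by (auto simp: N_def)
    then obtain v where v: "v \<in> cell n K y" "v \<in> \<Omega>" "y \<in> grid n K" by (auto simp: A_def)
    have "torus_dist n u v \<le> real (m + n) * (2 * pi / K)"
      by (rule torus_dist_cell[OF x(1) v(3) x(2) v(1) x(4)])
    also have "\<dots> = real (m + n) * (2 * h)" by (simp add: h_def)
    also have "\<dots> < r" using m(2) h by (simp add: pos_less_divide_eq)
    finally show "u \<in> torus_nbhd n r \<Omega>"
      using v(2) x(2) cell_subset_torus \<Omega>(2) by (auto simp: torus_nbhd_iff)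
  qed
  finally show ?thesis .
qed

text \<open>As the mesh tends to zero, the radius on the left increases to \<open>R + r\<close>, and the open balls
  exhaust the ball of this radius.\<close>

lemma torus_isoperimetry:
  assumes \<Omega>: "\<Omega> \<subseteq> torus n" "\<Omega> \<noteq> {}" and c: "c \<in> torus n" and "0 < R" "0 < r"
    and vol: "measure (torus_measure n) (open_ball n c R) \<le> measure (torus_measure n) \<Omega>"
  shows "measure (torus_measure n) (open_ball n c (R + r)) \<le> measure (torus_measure n) (torus_nbhd n r \<Omega>)"
proof -
  interpret prob_space "torus_measure n" by (rule prob_space_torus_measure)
  obtain k1 :: nat where k1: "real (n + 1) * pi / R < k1" using reals_Archimedean2 by blast
  obtain k2 :: nat where k2: "real (2 * n + 1) * (2 * pi) / r < k2" using reals_Archimedean2 by blast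
  define K where "K j = Suc (k1 + k2 + j)" for j
  define s where "s j = R + r - real (4 * n + 2) * (pi / K j)" for j
  have s_mono: "s i \<le> s j" if "i \<le> j" for i j
    using that unfolding s_def K_def by (intro diff_left_mono mult_left_mono divide_left_mono) auto
  have lim: "s \<longlonglongrightarrow> R + r"
  proof -
    have "filterlim K at_top sequentially" unfolding K_def
      by (intro filterlim_subseq) (auto simp: strict_mono_def)
    then have "(\<lambda>j. pi / K j) \<longlonglongrightarrow> 0"
      by (intro tendsto_divide_0[OF tendsto_const] filterlim_compose[OF filterlim_real_at_infinity_sequentially])
    from tendsto_diff[OF tendsto_const[of "R + r"] tendsto_mult[OF tendsto_const[of "real (4 * n + 2)"] this]]
    show ?thesis unfolding s_def[abs_def] by simp
  qed
  have Un: "(\<Union>j. open_ball n c (s j)) = open_ball n c (R + r)"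
  proof (intro equalityI subsetI)
    fix u assume "u \<in> open_ball n c (R + r)"
    then have u: "u \<in> torus n" "torus_dist n c u < R + r" by (auto simp: open_ball_def)
    from order_tendstoD(1)[OF lim u(2)] obtain j where "torus_dist n c u < s j"
      unfolding eventually_sequentially by blast
    then show "u \<in> (\<Union>j. open_ball n c (s j))" using u by (auto simp: open_ball_def)
  next
    fix u assume "u \<in> (\<Union>j. open_ball n c (s j))"
    then obtain j where j: "u \<in> open_ball n c (s j)" by (rule UN_E)
    have "s j \<le> R + r" unfolding s_def by simp
    with j show "u \<in> open_ball n c (R + r)"
      unfolding open_ball_def mem_Collect_eq by (intro conjI) linarith+
  qed
  have "incseq (\<lambda>j. open_ball n c (s j))"
  proof (rule incseq_SucI)
    fix j
    have "s j \<le> s (Suc j)" by (rule s_mono) simp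
    then show "open_ball n c (s j) \<subseteq> open_ball n c (s (Suc j))" by (auto simp: open_ball_def)
  qed
  then have "(\<lambda>j. prob (open_ball n c (s j))) \<longlonglongrightarrow> prob (\<Union>j. open_ball n c (s j))"
    by (rule finite_Lim_measure_incseq[rotated]) (auto simp: sets_open_ball[OF c])
  then have conv: "(\<lambda>j. prob (open_ball n c (s j))) \<longlonglongrightarrow> prob (open_ball n c (R + r))"
    by (simp only: Un)
  have le: "prob (open_ball n c (s j)) \<le> prob (torus_nbhd n r \<Omega>)" for j
    unfolding s_def
  proof (rule torus_isoperimetry_at_scale[OF \<Omega> c _ vol])
    have scale: "a * (q / K j) \<le> t" if "a * q / t < k" "0 < t" "k \<le> K j" for a q t k :: real
    proof -
      have "a * q / t \<le> K j" using that by linarith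
      moreover have "0 < real (K j)" by (simp add: K_def)
      ultimately show ?thesis using that(2) by (simp add: field_simps)
    qed
    show "real (n + 1) * (pi / K j) \<le> R" by (rule scale[OF k1 \<open>0 < R\<close>]) (simp add: K_def)
    show "real (2 * n + 1) * (2 * pi / K j) \<le> r" by (rule scale[OF k2 \<open>0 < r\<close>]) (simp add: K_def)
  qed (simp add: K_def)
  show ?thesis by (rule LIMSEQ_le_const2[OF conv]) (simp add: le)
qed

theorem corollary1p13:
  fixes n :: nat and \<Omega> B :: "(nat \<Rightarrow> complex) set" and r :: real
  assumes "n \<ge> 1"
    and "closedin (torus_topology n) \<Omega>"
    and "measure (torus_measure n) \<Omega> > 0"
    and "torus_ball n B"
    and "measure (torus_measure n) B = measure (torus_measure n) \<Omega>"
    and "r > 0"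
  shows "measure (torus_measure n) (torus_nbhd n r \<Omega>)
           \<ge> measure (torus_measure n) (torus_nbhd n r B)"
proof -
  interpret prob_space "torus_measure n" by (rule prob_space_torus_measure)
  interpret T: Metric_space "torus n" "torus_dist n" by (rule Metric_space_torus)
  have \<Omega>: "\<Omega> \<subseteq> torus n" "\<Omega> \<noteq> {}"
    using closedin_subset[OF assms(2)] assms(3) by auto
  from assms(4) obtain c R where c: "c \<in> torus n" "0 < R" and
    B: "B = T.mball c R \<or> B = T.mcball c R" by (auto simp: torus_ball_def)
  have B_sub: "open_ball n c R \<subseteq> B" "B \<subseteq> torus n" "\<And>y. y \<in> B \<Longrightarrow> torus_dist n c y \<le> R"
    using B c by (auto simp: open_ball_def)
  have "B \<in> events"
    using assms(3,5) by (metis less_irrefl measure_notin_sets)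
  then have "prob (open_ball n c R) \<le> prob \<Omega>"
    using finite_measure_mono[OF B_sub(1)] assms(5) by simp
  then have "prob (open_ball n c (R + r)) \<le> prob (torus_nbhd n r \<Omega>)"
    using \<Omega> c assms(6) by (intro torus_isoperimetry) auto
  moreover have "prob (torus_nbhd n r B) \<le> prob (open_ball n c (R + r))"
  proof (rule finite_measure_mono)
    show "torus_nbhd n r B \<subseteq> open_ball n c (R + r)"
    proof
      fix x assume x: "x \<in> torus_nbhd n r B"
      have "B \<noteq> {}" using assms(3,5) by auto
      with x obtain y where y: "x \<in> torus n" "y \<in> B" "torus_dist n x y < r"
        by (auto simp: torus_nbhd_iff)
      then have "torus_dist n c x \<le> torus_dist n c y + torus_dist n y x"
        using c B_sub by (intro torus_dist_triangle) auto
      then show "x \<in> open_ball n c (R + r)"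
        using y B_sub(3)[of y] torus_dist_commute[of n x y] by (simp add: open_ball_def)
    qed
  qed (rule sets_open_ball[OF c(1)])
  ultimately show ?thesis by simp
qed

end
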